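(* Let $\xi$ be an estimator of the drift such that, for some $u\in\Theta$, $$\mathbb{E}^u\big[\,\|\xi-u\|^2_{H^1_0}\,\big]<\infty .$$ Then $\xi$ is not unbiased.
   Context: Fix $T>0$ and let $X=(X_t)_{t\in[0,T]}$ be a Brownian motion on a filtered probability space $(\Omega,\mathcal{F},(\mathcal{F}_t)_{t\in[0,T]},\mathbb{P})$. $H^1_0=H^1_0(0,T)$ denotes the space of functions $h(t)=\int_0^t\dot h(s)\,ds$, $t\in[0,T]$, with $\dot h\in L^2(0,T)$ (only vanishing at $t=0$ is required), with $\|h\|_{H^1_0}:=\|\dot h\|_{L^2(0,T)}$; one sets $\|h\|_{H^1_0}:=+\infty$ for any Borel $h:[0,T]\to\mathbb{R}$ not in $H^1_0$. The parameter space $\Theta$ is a (nonempty) set of absolutely continuous adapted processes $u_t=\int_0^t\dot u_s\,ds$, $t\in[0,T]$, such that $\dot u$ satisfies the conditions of Girsanov's theorem: $\dot u$ is adapted, $\int_0^T\dot u_s^2\,ds<\infty$ a.s., and, with $$L^u:=\exp\Big[\int_0^T\dot u_s\,dX_s-\tfrac12\int_0^T\dot u_s^2\,ds\Big],$$ $\mathbb{P}^u:=L^u\,\mathbb{P}$ is a probability measure under which $X^u_t:=X_t-u_t$ is a Brownian motion on $[0,T]$. $\mathbb{E}^u$ denotes expectation under $\mathbb{P}^u$. It is assumed that $u+h\in\Theta$ for every $u\in\Theta$ and every (deterministic) $h\in H^1_0$, and that $u_t$ is $\mathbb{P}^u$-integrable for all $u\in\Theta$, $t\in[0,T]$. An estimator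 of the drift is any measurable stochastic process $\xi:\Omega\times[0,T]\to\mathbb{R}$ (not depending on $u$, not necessarily adapted). It is unbiased if, for every $u\in\Theta$ and $t\in[0,T]$, $\xi_t$ is $\mathbb{P}^u$-integrable and $\mathbb{E}^u[\xi_t]=\mathbb{E}^u[u_t]$. *)

theory Defs
  imports "HOL-Probability.Probability"
begin

section \<open>The space of absolutely continuous functions with square integrable derivative\<close>

text \<open>Functions on the interval from 0 to T are represented by functions on the whole real line
  whose values outside that interval never matter.\<close>

definition h1_derivative :: "real \<Rightarrow> (real \<Rightarrow> real) \<Rightarrow> (real \<Rightarrow> real) \<Rightarrow> bool" where
  "h1_derivative T h g \<longleftrightarrow>
     set_borel_measurable lborel {0..T} g \<and>
     set_integrable lborel {0..T} (\<lambda>s. (g s)\<^sup>2) \<and>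
     (\<forall>t\<in>{0..T}. h t = (LINT s:{0..t}|lborel. g s))"

definition H10 :: "real \<Rightarrow> (real \<Rightarrow> real) set" where
  "H10 T = {h. \<exists>g. h1_derivative T h g}"

text \<open>The derivative is unique almost everywhere, so the choice below does not affect the norm.\<close>

definition h1_norm :: "real \<Rightarrow> (real \<Rightarrow> real) \<Rightarrow> ennreal" where
  "h1_norm T h =
     (if h \<in> H10 T
      then ennreal (sqrt (LINT s:{0..T}|lborel. ((SOME g. h1_derivative T h g) s)\<^sup>2))
      else \<infinity>)"

section \<open>Brownian motion on a filtered probability space\<close>

definition filtered_prob_space :: "'a measure \<Rightarrow> (real \<Rightarrow> 'a measure) \<Rightarrow> real \<Rightarrow> bool" where
  "filtered_prob_space M F T \<longleftrightarrow>
     prob_space M \<and>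
     (\<forall>t\<in>{0..T}. subalgebra M (F t)) \<and>
     (\<forall>s\<in>{0..T}. \<forall>t\<in>{0..T}. s \<le> t \<longrightarrow> subalgebra (F t) (F s))"

definition adapted :: "(real \<Rightarrow> 'a measure) \<Rightarrow> real \<Rightarrow> (real \<Rightarrow> 'a \<Rightarrow> real) \<Rightarrow> bool" where
  "adapted F T Y \<longleftrightarrow> (\<forall>t\<in>{0..T}. Y t \<in> borel_measurable (F t))"

definition measurable_process :: "'a measure \<Rightarrow> real \<Rightarrow> (real \<Rightarrow> 'a \<Rightarrow> real) \<Rightarrow> bool" where
  "measurable_process M T Y \<longleftrightarrow>
     (\<lambda>(\<omega>, t). Y t \<omega>) \<in> borel_measurable (M \<Otimes>\<^sub>M restrict_space borel {0..T})"

definition brownian_motion ::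
    "'a measure \<Rightarrow> (real \<Rightarrow> 'a measure) \<Rightarrow> real \<Rightarrow> (real \<Rightarrow> 'a \<Rightarrow> real) \<Rightarrow> bool" where
  "brownian_motion M F T X \<longleftrightarrow>
     adapted F T X \<and>
     (AE \<omega> in M. X 0 \<omega> = 0) \<and>
     (AE \<omega> in M. continuous_on {0..T} (\<lambda>t. X t \<omega>)) \<and>
     (\<forall>s t. 0 \<le> s \<and> s < t \<and> t \<le> T \<longrightarrow>
        distributed M lborel (\<lambda>\<omega>. X t \<omega> - X s \<omega>) (normal_density 0 (sqrt (t - s))) \<and>
        prob_space.indep_set M (sets (F s))
          (sets (vimage_algebra (space M) (\<lambda>\<omega>. X t \<omega> - X s \<omega>) borel)))"

section \<open>The Ito integral\<close>

text \<open>A simple integrand is given by a partition \<open>p 0 \<le> \<dots> \<le> p n\<close> and bounded coefficients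
  \<open>c i\<close>, the value on the interval from \<open>p i\<close> (excluded) to \<open>p (i + 1)\<close> (included).\<close>

definition simple_integrand ::
    "'a measure \<Rightarrow> (real \<Rightarrow> 'a measure) \<Rightarrow> real \<Rightarrow> nat \<Rightarrow> (nat \<Rightarrow> real) \<Rightarrow> (nat \<Rightarrow> 'a \<Rightarrow> real) \<Rightarrow> bool" where
  "simple_integrand M F T n p c \<longleftrightarrow>
     (\<forall>i\<le>n. p i \<in> {0..T}) \<and>
     (\<forall>i<n. p i \<le> p (Suc i) \<and>
            c i \<in> borel_measurable (F (p i)) \<and>
            (\<exists>B. \<forall>\<omega>\<in>space M. \<bar>c i \<omega>\<bar> \<le> B))"

definition simple_process ::
    "nat \<Rightarrow> (nat \<Rightarrow> real) \<Rightarrow> (nat \<Rightarrow> 'a \<Rightarrow> real) \<Rightarrow> real \<Rightarrow> 'a \<Rightarrow> real" where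
  "simple_process n p c s \<omega> = (\<Sum>i<n. c i \<omega> * indicator {p i<..p (Suc i)} s)"

definition simple_ito ::
    "(real \<Rightarrow> 'a \<Rightarrow> real) \<Rightarrow> nat \<Rightarrow> (nat \<Rightarrow> real) \<Rightarrow> (nat \<Rightarrow> 'a \<Rightarrow> real) \<Rightarrow> 'a \<Rightarrow> real" where
  "simple_ito X n p c \<omega> = (\<Sum>i<n. c i \<omega> * (X (p (Suc i)) \<omega> - X (p i) \<omega>))"

text \<open>\<open>J\<close> is (a version of) the Ito integral of \<open>v\<close> against \<open>X\<close> over the interval from 0 to \<open>T\<close>:
  simple integrands approximate \<open>v\<close> in the sense that the time integral of the squared difference
  tends to 0 in probability, and their integrals tend to \<open>J\<close> in probability. This is the usual
  extension of the integral to adapted integrands with almost surely square integrable paths; the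
  integral is determined up to almost sure equality.\<close>

definition ito_integral ::
    "'a measure \<Rightarrow> (real \<Rightarrow> 'a measure) \<Rightarrow> real \<Rightarrow> (real \<Rightarrow> 'a \<Rightarrow> real) \<Rightarrow> (real \<Rightarrow> 'a \<Rightarrow> real) \<Rightarrow>
     ('a \<Rightarrow> real) \<Rightarrow> bool" where
  "ito_integral M F T X v J \<longleftrightarrow>
     J \<in> borel_measurable M \<and>
     (\<exists>n p c.
        (\<forall>k. simple_integrand M F T (n k) (p k) (c k)) \<and>
        (\<forall>\<epsilon>>0. (\<lambda>k. measure M {\<omega> \<in> space M.
            (\<integral>\<^sup>+ s\<in>{0..T}. ennreal ((simple_process (n k) (p k) (c k) s \<omega> - v s \<omega>)\<^sup>2) \<partial>lborel)
              > ennreal \<epsilon>}) \<longlonglongrightarrow> 0) \<and>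
        (\<forall>\<epsilon>>0. (\<lambda>k. measure M {\<omega> \<in> space M.
            \<bar>simple_ito X (n k) (p k) (c k) \<omega> - J \<omega>\<bar> > \<epsilon>}) \<longlonglongrightarrow> 0))"

section \<open>The drift model\<close>

definition drift_derivative ::
    "'a measure \<Rightarrow> (real \<Rightarrow> 'a measure) \<Rightarrow> real \<Rightarrow> (real \<Rightarrow> 'a \<Rightarrow> real) \<Rightarrow> (real \<Rightarrow> 'a \<Rightarrow> real) \<Rightarrow> bool" where
  "drift_derivative M F T u v \<longleftrightarrow>
     measurable_process M T v \<and> adapted F T v \<and>
     (AE \<omega> in M. set_integrable lborel {0..T} (\<lambda>s. (v s \<omega>)\<^sup>2)) \<and>
     (AE \<omega> in M. \<forall>t\<in>{0..T}. u t \<omega> = (LINT s:{0..t}|lborel. v s \<omega>))"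

definition girsanov_density ::
    "'a measure \<Rightarrow> (real \<Rightarrow> 'a measure) \<Rightarrow> real \<Rightarrow> (real \<Rightarrow> 'a \<Rightarrow> real) \<Rightarrow> (real \<Rightarrow> 'a \<Rightarrow> real) \<Rightarrow>
     ('a \<Rightarrow> real) \<Rightarrow> bool" where
  "girsanov_density M F T X u L \<longleftrightarrow>
     (\<exists>v J. drift_derivative M F T u v \<and> ito_integral M F T X v J \<and>
        L = (\<lambda>\<omega>. exp (J \<omega> - 1 / 2 * (LINT s:{0..T}|lborel. (v s \<omega>)\<^sup>2))))"

text \<open>Any two densities of \<open>u\<close> agree almost surely, so the measure does not depend on the choice.\<close>

definition drift_measure ::
    "'a measure \<Rightarrow> (real \<Rightarrow> 'a measure) \<Rightarrow> real \<Rightarrow> (real \<Rightarrow> 'a \<Rightarrow> real) \<Rightarrow> (real \<Rightarrow> 'a \<Rightarrow> real) \<Rightarrow>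
     'a measure" where
  "drift_measure M F T X u = density M (\<lambda>\<omega>. ennreal ((SOME L. girsanov_density M F T X u L) \<omega>))"

definition girsanov_drift ::
    "'a measure \<Rightarrow> (real \<Rightarrow> 'a measure) \<Rightarrow> real \<Rightarrow> (real \<Rightarrow> 'a \<Rightarrow> real) \<Rightarrow> (real \<Rightarrow> 'a \<Rightarrow> real) \<Rightarrow> bool" where
  "girsanov_drift M F T X u \<longleftrightarrow>
     adapted F T u \<and>
     (\<exists>L. girsanov_density M F T X u L) \<and>
     prob_space (drift_measure M F T X u) \<and>
     brownian_motion (drift_measure M F T X u) F T (\<lambda>t \<omega>. X t \<omega> - u t \<omega>)"

text \<open>The indicator in the shifted process makes the assumption independent of the values of \<open>h\<close>
  outside the time interval.\<close>

definition drift_parameter_space ::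
    "'a measure \<Rightarrow> (real \<Rightarrow> 'a measure) \<Rightarrow> real \<Rightarrow> (real \<Rightarrow> 'a \<Rightarrow> real) \<Rightarrow>
     (real \<Rightarrow> 'a \<Rightarrow> real) set \<Rightarrow> bool" where
  "drift_parameter_space M F T X \<Theta> \<longleftrightarrow>
     \<Theta> \<noteq> {} \<and>
     (\<forall>u\<in>\<Theta>. girsanov_drift M F T X u) \<and>
     (\<forall>u\<in>\<Theta>. \<forall>h\<in>H10 T. (\<lambda>t \<omega>. u t \<omega> + indicator {0..T} t * h t) \<in> \<Theta>) \<and>
     (\<forall>u\<in>\<Theta>. \<forall>t\<in>{0..T}. integrable (drift_measure M F T X u) (u t))"

definition unbiased_estimator ::
    "'a measure \<Rightarrow> (real \<Rightarrow> 'a measure) \<Rightarrow> real \<Rightarrow> (real \<Rightarrow> 'a \<Rightarrow> real) \<Rightarrow>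
     (real \<Rightarrow> 'a \<Rightarrow> real) set \<Rightarrow> (real \<Rightarrow> 'a \<Rightarrow> real) \<Rightarrow> bool" where
  "unbiased_estimator M F T X \<Theta> \<xi> \<longleftrightarrow>
     (\<forall>u\<in>\<Theta>. \<forall>t\<in>{0..T}.
        integrable (drift_measure M F T X u) (\<xi> t) \<and>
        (\<integral>\<omega>. \<xi> t \<omega> \<partial>drift_measure M F T X u) = (\<integral>\<omega>. u t \<omega> \<partial>drift_measure M F T X u))"

end

theory Submission
  imports Defs
begin

text \<open>The idea is that each of \<open>n\<close> independent directions of the drift costs an unbiased estimator a
  fixed amount of risk, while the norm collects the costs of all directions.

  Fix a drift \<open>u\<close>, write \<open>\<delta> = \<xi> - u\<close>, and perturb \<open>u\<close> by the ramp that rises with slope 1 from time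
  \<open>a\<close> to time \<open>b\<close>. The measure of the perturbed drift has density
  \<open>Z = exp ((X b - u b) - (X a - u a) - (b - a) / 2)\<close> with respect to the measure of \<open>u\<close>, under which
  \<open>X - u\<close> is a Brownian motion. Unbiasedness at \<open>u\<close> says that \<open>\<delta> b - \<delta> a\<close> has mean zero, and
  unbiasedness at the perturbed drift says that \<open>Z * (\<delta> b - \<delta> a)\<close> has mean \<open>b - a\<close>. Since
  \<open>(Z - 1)\<^sup>2\<close> has mean \<open>exp (b - a) - 1\<close>, the inequality between arithmetic and geometric means forces
  \<open>(\<delta> b - \<delta> a)\<^sup>2\<close> to have mean at least \<open>(b - a) / 2\<close> as soon as \<open>b - a \<le> 1\<close>; these are
  \<open>translation_variance_bound\<close> and \<open>unbiased_increment_bound\<close>.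

  On the other hand, by Cauchy-Schwarz the squared norm of a path dominates \<open>n / T\<close> times the sum of
  its squared increments over \<open>n\<close> intervals of length \<open>T / n\<close> (\<open>h1_norm_ge_increments\<close>). Adding the
  bounds for these intervals shows that the risk is at least \<open>n / 2\<close>, for every \<open>n \<ge> T\<close>.

  Most of the work goes into the formula for \<open>Z\<close> (\<open>log_density_ratio\<close>). The density of each drift is
  defined through some derivative of the drift and some version of its Ito integral, the latter
  characterised by approximation with simple integrands. Comparing two densities therefore requires
  that the integral is linear (\<open>ito_integral_diff\<close>, by passing to a common partition) and unique
  (\<open>ito_integral_unique_0\<close>, by an estimate in probability that follows from the isometry and a
  truncation), and that derivatives are unique almost everywhere (\<open>h1_derivative_unique\<close>).\<close>

section \<open>Brownian increments and the Ito integral of simple integrands\<close>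

locale brownian_space = prob_space M for M :: "'a measure" +
  fixes F :: "real \<Rightarrow> 'a measure" and T :: real and X :: "real \<Rightarrow> 'a \<Rightarrow> real"
  assumes filtered: "filtered_prob_space M F T"
    and brownian: "brownian_motion M F T X"
begin

lemma measurable_filtration_mono:
  assumes "f \<in> borel_measurable (F s)" "0 \<le> s" "s \<le> t" "t \<le> T"
  shows "f \<in> borel_measurable (F t)"
proof -
  have "subalgebra (F t) (F s)"
    using filtered assms by (auto simp: filtered_prob_space_def)
  from measurable_from_subalg[OF this assms(1)] show ?thesis .
qed

lemma measurable_filtration:
  assumes "f \<in> borel_measurable (F s)" "0 \<le> s" "s \<le> T"
  shows "f \<in> borel_measurable M"
proof -
  have "subalgebra M (F s)"
    using filtered assms by (auto simp: filtered_prob_space_def)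
  from measurable_from_subalg[OF this assms(1)] show ?thesis .
qed

lemma space_filtration: "0 \<le> s \<Longrightarrow> s \<le> T \<Longrightarrow> space (F s) = space M"
  using filtered by (auto simp: filtered_prob_space_def subalgebra_def)

lemma process_adapted: "0 \<le> s \<Longrightarrow> s \<le> T \<Longrightarrow> X s \<in> borel_measurable (F s)"
  using brownian by (auto simp: brownian_motion_def adapted_def)

lemma process_measurable: "0 \<le> s \<Longrightarrow> s \<le> T \<Longrightarrow> X s \<in> borel_measurable M"
  by (rule measurable_filtration[OF process_adapted])

text \<open>Independence is postulated for the sigma-algebras of the past and of the increment; this is what
  it says about expectations.\<close>

lemma expectation_past_times_increment_function:
  fixes f :: "real \<Rightarrow> real"
  assumes st: "0 \<le> s" "s < t" "t \<le> T"
    and Y: "Y \<in> borel_measurable (F s)" "integrable M Y"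
    and f: "f \<in> borel_measurable borel" "integrable M (\<lambda>\<omega>. f (X t \<omega> - X s \<omega>))"
  shows "integrable M (\<lambda>\<omega>. Y \<omega> * f (X t \<omega> - X s \<omega>))" (is ?int)
    and "expectation (\<lambda>\<omega>. Y \<omega> * f (X t \<omega> - X s \<omega>)) =
      expectation Y * expectation (\<lambda>\<omega>. f (X t \<omega> - X s \<omega>))" (is ?eq)
proof -
  let ?D = "\<lambda>\<omega>. X t \<omega> - X s \<omega>"
  have ind: "indep_set (sets (F s)) (sets (vimage_algebra (space M) ?D borel))"
    using brownian st by (auto simp: brownian_motion_def)
  have Dm: "?D \<in> borel_measurable M"
    using st by (intro borel_measurable_diff process_measurable) auto
  have subY: "sigma_sets (space M) {Y -` A \<inter> space M |A. A \<in> sets borel} \<subseteq> sets (F s)"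
  proof -
    have "{Y -` A \<inter> space M |A. A \<in> sets borel} \<subseteq> sets (F s)"
      using measurable_sets[OF Y(1)] space_filtration[of s] st by auto
    from sets.sigma_sets_subset[OF this] show ?thesis using space_filtration[of s] st by simp
  qed
  have subD: "sigma_sets (space M) {(\<lambda>\<omega>. f (?D \<omega>)) -` A \<inter> space M |A. A \<in> sets borel}
      \<subseteq> sets (vimage_algebra (space M) ?D borel)"
  proof -
    have "(\<lambda>\<omega>. f (?D \<omega>)) \<in> borel_measurable (vimage_algebra (space M) ?D borel)"
      by (intro measurable_compose[OF _ f(1)] measurable_vimage_algebra1) auto
    from measurable_sets[OF this]
    have "{(\<lambda>\<omega>. f (?D \<omega>)) -` A \<inter> space M |A. A \<in> sets borel} \<subseteq> sets (vimage_algebra (space M) ?D borel)"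
      by auto
    from sets.sigma_sets_subset[OF this] show ?thesis by simp
  qed
  have "indep_var borel Y borel (\<lambda>\<omega>. f (?D \<omega>))"
    unfolding indep_var_eq
  proof (intro conjI)
    show "Y \<in> borel_measurable M" "(\<lambda>\<omega>. f (?D \<omega>)) \<in> borel_measurable M"
      using Y f by auto
    show "indep_set (sigma_sets (space M) {Y -` A \<inter> space M |A. A \<in> sets borel})
        (sigma_sets (space M) {(\<lambda>\<omega>. f (?D \<omega>)) -` A \<inter> space M |A. A \<in> sets borel})"
      using ind subY subD unfolding indep_sets2_eq by blast
  qed
  from indep_var_integrable[OF this Y(2) f(2)] indep_var_lebesgue_integral[OF this Y(2) f(2)]
  show ?int ?eq by auto
qed

lemma increment_moments:
  assumes st: "0 \<le> s" "s < t" "t \<le> T"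
  shows "integrable M (\<lambda>\<omega>. X t \<omega> - X s \<omega>)" "expectation (\<lambda>\<omega>. X t \<omega> - X s \<omega>) = 0"
    "integrable M (\<lambda>\<omega>. (X t \<omega> - X s \<omega>)\<^sup>2)" "expectation (\<lambda>\<omega>. (X t \<omega> - X s \<omega>)\<^sup>2) = t - s"
proof -
  let ?D = "\<lambda>\<omega>. X t \<omega> - X s \<omega>"
  have d: "distributed M lborel ?D (normal_density 0 (sqrt (t - s)))"
    using brownian st by (auto simp: brownian_motion_def)
  have s: "0 < sqrt (t - s)" using st by simp
  show e: "expectation ?D = 0" using normal_distributed_expectation[OF s d] .
  have "variance ?D = t - s" using normal_distributed_variance[OF s d] st by simp
  then show "expectation (\<lambda>\<omega>. (?D \<omega>)\<^sup>2) = t - s" using e by simp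
  show "integrable M ?D"
    using distributed_integrable[OF d, of "\<lambda>x. x"] integrable_normal_moment[OF s, of 0 1] by simp
  show "integrable M (\<lambda>\<omega>. (?D \<omega>)\<^sup>2)"
    using distributed_integrable[OF d, of "\<lambda>x. x\<^sup>2"] integrable_normal_moment[OF s, of 0 2] by simp
qed

lemma past_times_increment:
  assumes st: "0 \<le> s" "s \<le> t" "t \<le> T"
    and Y: "Y \<in> borel_measurable (F s)" "integrable M Y"
  shows "integrable M (\<lambda>\<omega>. Y \<omega> * (X t \<omega> - X s \<omega>))"
    and "expectation (\<lambda>\<omega>. Y \<omega> * (X t \<omega> - X s \<omega>)) = 0"
    and "integrable M (\<lambda>\<omega>. Y \<omega> * (X t \<omega> - X s \<omega>)\<^sup>2)"
    and "expectation (\<lambda>\<omega>. Y \<omega> * (X t \<omega> - X s \<omega>)\<^sup>2) = expectation Y * (t - s)"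
proof -
  have "integrable M (\<lambda>\<omega>. Y \<omega> * (X t \<omega> - X s \<omega>)) \<and> expectation (\<lambda>\<omega>. Y \<omega> * (X t \<omega> - X s \<omega>)) = 0 \<and>
     integrable M (\<lambda>\<omega>. Y \<omega> * (X t \<omega> - X s \<omega>)\<^sup>2) \<and>
     expectation (\<lambda>\<omega>. Y \<omega> * (X t \<omega> - X s \<omega>)\<^sup>2) = expectation Y * (t - s)"
  proof (cases "s = t")
    case False
    then have st': "s < t" using st by simp
    note m = increment_moments[OF st(1) st' st(3)]
    show ?thesis
      using expectation_past_times_increment_function[OF st(1) st' st(3) Y, of "\<lambda>x. x"]
        expectation_past_times_increment_function[OF st(1) st' st(3) Y, of "\<lambda>x. x\<^sup>2"] m
      by simp
  qed simp
  then show "integrable M (\<lambda>\<omega>. Y \<omega> * (X t \<omega> - X s \<omega>))"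
    and "expectation (\<lambda>\<omega>. Y \<omega> * (X t \<omega> - X s \<omega>)) = 0"
    and "integrable M (\<lambda>\<omega>. Y \<omega> * (X t \<omega> - X s \<omega>)\<^sup>2)"
    and "expectation (\<lambda>\<omega>. Y \<omega> * (X t \<omega> - X s \<omega>)\<^sup>2) = expectation Y * (t - s)"
    by auto
qed

lemma simple_integrand_coeff:
  assumes "simple_integrand M F T n p c" "i < n"
  shows "0 \<le> p i" "p i \<le> p (Suc i)" "p (Suc i) \<le> T" "c i \<in> borel_measurable (F (p i))"
    "\<exists>B. \<forall>\<omega>\<in>space M. \<bar>c i \<omega>\<bar> \<le> B" "c i \<in> borel_measurable M"
proof -
  have "p i \<in> {0..T}" "p (Suc i) \<in> {0..T}" using assms by (auto simp: simple_integrand_def)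
  then show p: "0 \<le> p i" "p (Suc i) \<le> T" by auto
  show le: "p i \<le> p (Suc i)" and m: "c i \<in> borel_measurable (F (p i))"
    and "\<exists>B. \<forall>\<omega>\<in>space M. \<bar>c i \<omega>\<bar> \<le> B"
    using assms unfolding simple_integrand_def by blast+
  show "c i \<in> borel_measurable M"
    using measurable_filtration[OF m p(1)] le p(2) by linarith
qed

lemma simple_integrand_mono:
  assumes "simple_integrand M F T n p c" "i \<le> j" "j \<le> n"
  shows "p i \<le> p j"
  using assms(2,3)
proof (induction j rule: dec_induct)
  case (step k)
  then have "k < n" "p i \<le> p k" by auto
  from order_trans[OF this(2) simple_integrand_coeff(2)[OF assms(1) this(1)]] show ?case .
qed simp

lemma simple_integrand_point:
  assumes "simple_integrand M F T n p c" "i \<le> n"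
  shows "0 \<le> p i" "p i \<le> T"
  using assms by (auto simp: simple_integrand_def)

text \<open>Induction over the cells: the mixed term of the square vanishes since the new increment is
  centred and independent of the past. The measurability statement is carried along in order to
  recognise the partial integral as belonging to that past.\<close>

lemma simple_ito_isometry:
  assumes "simple_integrand M F T n p c"
  shows "simple_ito X n p c \<in> borel_measurable (F (p n)) \<and>
    integrable M (\<lambda>\<omega>. (simple_ito X n p c \<omega>)\<^sup>2) \<and>
    expectation (\<lambda>\<omega>. (simple_ito X n p c \<omega>)\<^sup>2) =
      expectation (\<lambda>\<omega>. \<Sum>i<n. (c i \<omega>)\<^sup>2 * (p (Suc i) - p i))"
  using assms
proof (induction n)
  case 0
  then show ?case by (simp add: simple_ito_def)
next
  case (Suc n)
  have si: "simple_integrand M F T n p c"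
    using Suc.prems by (auto simp: simple_integrand_def)
  note c = simple_integrand_coeff[OF Suc.prems]
  have cn: "0 \<le> p n" "p n \<le> p (Suc n)" "p (Suc n) \<le> T" "c n \<in> borel_measurable (F (p n))"
    using c[of n] by auto
  obtain B where B: "\<And>\<omega>. \<omega> \<in> space M \<Longrightarrow> \<bar>c n \<omega>\<bar> \<le> B" using c(5)[of n] by auto
  have [measurable]: "c n \<in> borel_measurable M" using c(6)[of n] by simp
  let ?I = "simple_ito X n p c" and ?D = "\<lambda>\<omega>. X (p (Suc n)) \<omega> - X (p n) \<omega>"
  from Suc.IH[OF si] have I: "?I \<in> borel_measurable (F (p n))" "integrable M (\<lambda>\<omega>. (?I \<omega>)\<^sup>2)"
    and eq: "expectation (\<lambda>\<omega>. (?I \<omega>)\<^sup>2) = expectation (\<lambda>\<omega>. \<Sum>i<n. (c i \<omega>)\<^sup>2 * (p (Suc i) - p i))"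
    by auto
  have IM: "?I \<in> borel_measurable M" using measurable_filtration[OF I(1)] cn by auto
  have "integrable M ?I" using square_integrable_imp_integrable[OF IM I(2)] .
  then have ci: "integrable M (\<lambda>\<omega>. c n \<omega> * ?I \<omega>)"
  proof (rule Bochner_Integration.integrable_bound[OF integrable_mult_right[of B]])
    show "AE \<omega> in M. norm (c n \<omega> * ?I \<omega>) \<le> norm (B * ?I \<omega>)"
    proof (rule AE_I2)
      fix \<omega> assume "\<omega> \<in> space M"
      from B[OF this] show "norm (c n \<omega> * ?I \<omega>) \<le> norm (B * ?I \<omega>)"
        by (auto simp: abs_mult intro!: mult_right_mono)
    qed
  qed (use IM in measurable)
  have c2: "integrable M (\<lambda>\<omega>. (c i \<omega>)\<^sup>2)" if i: "i < Suc n" for i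
  proof -
    obtain B where B: "\<And>\<omega>. \<omega> \<in> space M \<Longrightarrow> \<bar>c i \<omega>\<bar> \<le> B" using c(5)[OF i] by auto
    have [measurable]: "c i \<in> borel_measurable M" using c(6)[OF i] .
    show ?thesis
    proof (rule integrable_const_bound[of _ "B\<^sup>2"])
      show "AE \<omega> in M. norm ((c i \<omega>)\<^sup>2) \<le> B\<^sup>2"
      proof (rule AE_I2)
        fix \<omega> assume "\<omega> \<in> space M"
        from power_mono[OF B[OF this], of 2] show "norm ((c i \<omega>)\<^sup>2) \<le> B\<^sup>2" by simp
      qed
    qed measurable
  qed
  have D: "?D \<in> borel_measurable (F (p (Suc n)))"
    using measurable_filtration_mono[OF process_adapted, of "p n" "p (Suc n)"]
      process_adapted[of "p (Suc n)"] cn by auto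
  have split: "simple_ito X (Suc n) p c = (\<lambda>\<omega>. ?I \<omega> + c n \<omega> * ?D \<omega>)"
    by (auto simp: simple_ito_def)
  have sq: "(\<lambda>\<omega>. (simple_ito X (Suc n) p c \<omega>)\<^sup>2) =
      (\<lambda>\<omega>. (?I \<omega>)\<^sup>2 + 2 * (c n \<omega> * ?I \<omega> * ?D \<omega>) + (c n \<omega>)\<^sup>2 * (?D \<omega>)\<^sup>2)"
    by (auto simp: split power2_eq_square algebra_simps)
  have "(\<lambda>\<omega>. c n \<omega> * ?I \<omega>) \<in> borel_measurable (F (p n))" "(\<lambda>\<omega>. (c n \<omega>)\<^sup>2) \<in> borel_measurable (F (p n))"
    using cn I by measurable
  from past_times_increment[OF cn(1-3) this(1) ci] past_times_increment[OF cn(1-3) this(2) c2[of n]]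
  have cross: "integrable M (\<lambda>\<omega>. c n \<omega> * ?I \<omega> * ?D \<omega>)" "expectation (\<lambda>\<omega>. c n \<omega> * ?I \<omega> * ?D \<omega>) = 0"
    and last: "integrable M (\<lambda>\<omega>. (c n \<omega>)\<^sup>2 * (?D \<omega>)\<^sup>2)"
    "expectation (\<lambda>\<omega>. (c n \<omega>)\<^sup>2 * (?D \<omega>)\<^sup>2) = expectation (\<lambda>\<omega>. (c n \<omega>)\<^sup>2) * (p (Suc n) - p n)"
    by auto
  have "simple_ito X (Suc n) p c \<in> borel_measurable (F (p (Suc n)))"
    unfolding split
    by (intro borel_measurable_add borel_measurable_times D
        measurable_filtration_mono[OF I(1)] measurable_filtration_mono[OF cn(4)] cn)
  moreover have "integrable M (\<lambda>\<omega>. (simple_ito X (Suc n) p c \<omega>)\<^sup>2)"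
    unfolding sq using I(2) cross last by (intro Bochner_Integration.integrable_add integrable_mult_right) auto
  moreover have "expectation (\<lambda>\<omega>. (simple_ito X (Suc n) p c \<omega>)\<^sup>2) =
      expectation (\<lambda>\<omega>. (?I \<omega>)\<^sup>2) + expectation (\<lambda>\<omega>. (c n \<omega>)\<^sup>2) * (p (Suc n) - p n)"
    unfolding sq using I(2) cross last by simp
  moreover have "expectation (\<lambda>\<omega>. \<Sum>i<Suc n. (c i \<omega>)\<^sup>2 * (p (Suc i) - p i)) =
      expectation (\<lambda>\<omega>. \<Sum>i<n. (c i \<omega>)\<^sup>2 * (p (Suc i) - p i)) + expectation (\<lambda>\<omega>. (c n \<omega>)\<^sup>2) * (p (Suc n) - p n)"
  proof -
    have "integrable M (\<lambda>\<omega>. \<Sum>i<n. (c i \<omega>)\<^sup>2 * (p (Suc i) - p i))"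
      using c2 by (intro Bochner_Integration.integrable_sum integrable_mult_left) auto
    then show ?thesis using c2[of n] by simp
  qed
  ultimately show ?case using eq by simp
qed

text \<open>The inequality behind the uniqueness of the Ito integral. A small time integral of the
  squared integrand controls the stochastic integral even though the isometry may be out of
  control on an event of small probability: cut the integrand off as soon as its accumulated energy
  exceeds \<open>\<delta>\<close>. The truncated integrand is still adapted, because the energy up to and including
  cell \<open>i\<close> depends on the coefficients of the cells up to \<open>i\<close> alone; it has energy at most \<open>\<delta>\<close>, so
  Chebyshev's inequality applies; and it agrees with the original one wherever the total energy is
  at most \<open>\<delta>\<close>.\<close>

lemma simple_ito_tail:
  assumes si: "simple_integrand M F T n p c" and \<epsilon>: "\<epsilon> > 0" and \<delta>: "\<delta> \<ge> 0"
  shows "measure M {\<omega> \<in> space M. \<bar>simple_ito X n p c \<omega>\<bar> > \<epsilon>} \<le>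
    measure M {\<omega> \<in> space M. (\<Sum>i<n. (c i \<omega>)\<^sup>2 * (p (Suc i) - p i)) > \<delta>} + \<delta> / \<epsilon>\<^sup>2"
proof -
  define S where "S i \<omega> = (\<Sum>j\<le>i. (c j \<omega>)\<^sup>2 * (p (Suc j) - p j))" for i \<omega>
  define e where "e i \<omega> = (if S i \<omega> \<le> \<delta> then c i \<omega> else 0)" for i \<omega>
  note c = simple_integrand_coeff[OF si]
  note [measurable] = c(6)
  let ?Q = "\<lambda>c \<omega>. \<Sum>i<n. (c i \<omega>)\<^sup>2 * (p (Suc i) - p i)"
  have S_mono: "S i \<omega> \<le> S j \<omega>" if "i \<le> j" "j < n" for i j \<omega>
    unfolding S_def using that c(2) by (intro sum_mono2) (auto intro!: mult_nonneg_nonneg)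
  have S_meas: "S i \<in> borel_measurable (F (p i))" if "i < n" for i
    unfolding S_def
  proof (intro borel_measurable_sum borel_measurable_times borel_measurable_power borel_measurable_const)
    fix j assume "j \<in> {..i}"
    then show "c j \<in> borel_measurable (F (p i))"
      using that c simple_integrand_mono[OF si, of j i]
      by (intro measurable_filtration_mono[OF c(4)[of j]]) (auto intro: order_trans)
  qed
  have si_e: "simple_integrand M F T n p e"
    unfolding simple_integrand_def
  proof (intro conjI allI impI)
    fix i assume i: "i < n"
    note [measurable] = S_meas[OF i] c(4)[OF i]
    show "e i \<in> borel_measurable (F (p i))" unfolding e_def by measurable
    obtain B where "\<forall>\<omega>\<in>space M. \<bar>c i \<omega>\<bar> \<le> B" using c(5)[OF i] by auto
    then have "\<forall>\<omega>\<in>space M. \<bar>e i \<omega>\<bar> \<le> \<bar>B\<bar>" by (auto simp: e_def)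
    then show "\<exists>B. \<forall>\<omega>\<in>space M. \<bar>e i \<omega>\<bar> \<le> B" by blast
  qed (use si in \<open>auto simp: simple_integrand_def\<close>)
  note [measurable] = simple_integrand_coeff(6)[OF si_e]
  have e_le: "(\<Sum>i<m. (e i \<omega>)\<^sup>2 * (p (Suc i) - p i)) \<le> \<delta>" if "m \<le> n" for m \<omega>
    using that
  proof (induction m)
    case (Suc m)
    show ?case
    proof (cases "S m \<omega> \<le> \<delta>")
      case True
      then have "e i \<omega> = c i \<omega>" if "i < Suc m" for i
        using S_mono[of i m \<omega>] that Suc.prems by (auto simp: e_def)
      then have "(\<Sum>i<Suc m. (e i \<omega>)\<^sup>2 * (p (Suc i) - p i)) = S m \<omega>"
        unfolding S_def lessThan_Suc_atMost[symmetric] by (intro sum.cong refl) simp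
      then show ?thesis using True by (simp only:)
    next
      case False
      then have "e m \<omega> = 0" by (simp add: e_def)
      then show ?thesis using Suc.IH Suc.prems by simp
    qed
  qed (use \<delta> in simp)
  have I_e: "simple_ito X n p e \<in> borel_measurable M" and I2_e: "integrable M (\<lambda>\<omega>. (simple_ito X n p e \<omega>)\<^sup>2)"
    and iso: "expectation (\<lambda>\<omega>. (simple_ito X n p e \<omega>)\<^sup>2) = expectation (?Q e)"
    using simple_ito_isometry[OF si_e] measurable_filtration simple_integrand_point[OF si_e, of n] by auto
  have I_c: "simple_ito X n p c \<in> borel_measurable M"
    using simple_ito_isometry[OF si] measurable_filtration simple_integrand_point[OF si, of n] by auto
  have [measurable]: "?Q c \<in> borel_measurable M" "?Q e \<in> borel_measurable M" by measurable
  note [measurable] = I_e I_c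
  have Q_nonneg: "0 \<le> ?Q e \<omega>" for \<omega>
    using c(2) by (intro sum_nonneg) auto
  have "integrable M (?Q e)"
    using e_le[of n] Q_nonneg by (intro integrable_const_bound[of _ \<delta>]) (simp_all add: abs_of_nonneg)
  then have "expectation (?Q e) \<le> expectation (\<lambda>_. \<delta>)"
    using e_le[of n] by (intro integral_mono) auto
  then have le: "expectation (\<lambda>\<omega>. (simple_ito X n p e \<omega>)\<^sup>2) \<le> \<delta>" using iso by (simp add: prob_space)
  have "measure M {\<omega> \<in> space M. \<bar>simple_ito X n p e \<omega>\<bar> > \<epsilon>} \<le>
      measure M {\<omega> \<in> space M. (simple_ito X n p e \<omega>)\<^sup>2 \<ge> \<epsilon>\<^sup>2}"
    using \<epsilon> by (intro finite_measure_mono) (auto intro: power2_le_iff_abs_le[THEN iffD2] simp: abs_le_square_iff[symmetric])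
  also have "\<dots> \<le> expectation (\<lambda>\<omega>. (simple_ito X n p e \<omega>)\<^sup>2) / \<epsilon>\<^sup>2"
    using \<epsilon> by (intro integral_Markov_inequality_measure[OF I2_e, of "{}"]) auto
  also have "\<dots> \<le> \<delta> / \<epsilon>\<^sup>2" using le by (intro divide_right_mono) auto
  finally have tail_e: "measure M {\<omega> \<in> space M. \<bar>simple_ito X n p e \<omega>\<bar> > \<epsilon>} \<le> \<delta> / \<epsilon>\<^sup>2" .
  have same: "simple_ito X n p e \<omega> = simple_ito X n p c \<omega>" if "?Q c \<omega> \<le> \<delta>" for \<omega>
  proof -
    have "e i \<omega> = c i \<omega>" if i: "i < n" for i
    proof -
      have "S i \<omega> \<le> ?Q c \<omega>"
        unfolding S_def using i c(2) by (intro sum_mono2) (auto intro!: mult_nonneg_nonneg)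
      then show ?thesis using \<open>?Q c \<omega> \<le> \<delta>\<close> by (simp add: e_def)
    qed
    then show ?thesis by (simp add: simple_ito_def)
  qed
  have "measure M {\<omega> \<in> space M. \<bar>simple_ito X n p c \<omega>\<bar> > \<epsilon>} \<le>
      measure M ({\<omega> \<in> space M. ?Q c \<omega> > \<delta>} \<union> {\<omega> \<in> space M. \<bar>simple_ito X n p e \<omega>\<bar> > \<epsilon>})"
    using same by (intro finite_measure_mono) (auto simp: not_le[symmetric])
  also have "\<dots> \<le> measure M {\<omega> \<in> space M. ?Q c \<omega> > \<delta>} + measure M {\<omega> \<in> space M. \<bar>simple_ito X n p e \<omega>\<bar> > \<epsilon>}"
    by (intro measure_Un_le) measurable
  finally show ?thesis using tail_e by simp
qed

end

lemma simple_process_eq_0: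
  assumes "\<And>i. i < n \<Longrightarrow> p (Suc i) < s"
  shows "simple_process n p c s \<omega> = 0"
  unfolding simple_process_def using assms by (intro sum.neutral) (auto simp: indicator_def not_le dest!: less_imp_not_less)

text \<open>The cells are disjoint, so no mixed terms appear.\<close>

lemma simple_process_squared:
  assumes mono: "\<And>i j. i \<le> j \<Longrightarrow> j \<le> n \<Longrightarrow> p i \<le> p j"
  shows "(simple_process n p c s \<omega>)\<^sup>2 = (\<Sum>i<n. (c i \<omega>)\<^sup>2 * indicator {p i<..p (Suc i)} s)"
  using mono
proof (induction n)
  case (Suc n)
  have "simple_process n p c s \<omega> = 0" if "p n < s"
  proof (rule simple_process_eq_0)
    fix i assume "i < n"
    then have "p (Suc i) \<le> p n" using Suc.prems[of "Suc i" n] by simp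
    then show "p (Suc i) < s" using that by simp
  qed
  then have "simple_process n p c s \<omega> * (c n \<omega> * indicator {p n<..p (Suc n)} s) = 0"
    by (auto simp: indicator_def)
  moreover have "simple_process (Suc n) p c s \<omega> =
      simple_process n p c s \<omega> + c n \<omega> * indicator {p n<..p (Suc n)} s"
    by (simp add: simple_process_def)
  ultimately have "(simple_process (Suc n) p c s \<omega>)\<^sup>2 =
      (simple_process n p c s \<omega>)\<^sup>2 + (c n \<omega> * indicator {p n<..p (Suc n)} s)\<^sup>2"
    by (simp add: power2_sum)
  also have "(c n \<omega> * indicator {p n<..p (Suc n)} s)\<^sup>2 = (c n \<omega>)\<^sup>2 * indicator {p n<..p (Suc n)} s"
    by (simp add: power_mult_distrib indicator_def)
  finally show ?case using Suc.IH Suc.prems by simp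
qed (simp add: simple_process_def)

lemma nn_integral_simple_process:
  assumes mono: "\<And>i j. i \<le> j \<Longrightarrow> j \<le> n \<Longrightarrow> p i \<le> p j"
    and range: "\<And>i. i \<le> n \<Longrightarrow> 0 \<le> p i \<and> p i \<le> T"
  shows "(\<integral>\<^sup>+ s\<in>{0..T}. ennreal ((simple_process n p c s \<omega>)\<^sup>2) \<partial>lborel) =
    ennreal (\<Sum>i<n. (c i \<omega>)\<^sup>2 * (p (Suc i) - p i))"
proof -
  have sq: "(simple_process n p c s \<omega>)\<^sup>2 = (\<Sum>i<n. (c i \<omega>)\<^sup>2 * indicator {p i<..p (Suc i)} s)" for s
    by (rule simple_process_squared) (rule mono)
  have "(\<integral>\<^sup>+ s\<in>{0..T}. ennreal ((simple_process n p c s \<omega>)\<^sup>2) \<partial>lborel) =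
      (\<integral>\<^sup>+ s. (\<Sum>i<n. ennreal ((c i \<omega>)\<^sup>2) * indicator {p i<..p (Suc i)} s) \<partial>lborel)"
  proof (rule nn_integral_cong)
    fix s
    have "ennreal ((simple_process n p c s \<omega>)\<^sup>2) * indicator {0..T} s =
        (\<Sum>i<n. ennreal ((c i \<omega>)\<^sup>2) * indicator {p i<..p (Suc i)} s) * indicator {0..T} s"
      unfolding sq
      by (subst sum_ennreal[symmetric]) (auto simp: ennreal_mult ennreal_indicator)
    also have "\<dots> = (\<Sum>i<n. ennreal ((c i \<omega>)\<^sup>2) * indicator {p i<..p (Suc i)} s)"
      unfolding sum_distrib_right
    proof (intro sum.cong refl)
      fix i assume "i \<in> {..<n}"
      then have "0 \<le> p i" "p (Suc i) \<le> T" using range[of i] range[of "Suc i"] by auto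
      then show "ennreal ((c i \<omega>)\<^sup>2) * indicator {p i<..p (Suc i)} s * indicator {0..T} s =
          ennreal ((c i \<omega>)\<^sup>2) * indicator {p i<..p (Suc i)} s"
        by (auto simp: indicator_def)
    qed
    finally show "ennreal ((simple_process n p c s \<omega>)\<^sup>2) * indicator {0..T} s =
        (\<Sum>i<n. ennreal ((c i \<omega>)\<^sup>2) * indicator {p i<..p (Suc i)} s)" .
  qed
  also have "\<dots> = (\<Sum>i<n. ennreal ((c i \<omega>)\<^sup>2) * ennreal (p (Suc i) - p i))"
    using mono by (subst nn_integral_sum) (auto simp: nn_integral_cmult_indicator intro!: sum.cong)
  also have "\<dots> = ennreal (\<Sum>i<n. (c i \<omega>)\<^sup>2 * (p (Suc i) - p i))"
    using mono by (subst sum_ennreal[symmetric]) (auto simp: ennreal_mult)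
  finally show ?thesis .
qed

text \<open>Every cell of the grid \<open>q\<close> lies either inside or outside the interval between two grid points,
  and which of the two can be read off from its right end point. With \<open>f\<close> a path this decomposes an
  increment of the path, with \<open>f x\<close> the truth value of \<open>s \<le> x\<close> the indicator of an interval.\<close>

lemma grid_telescope:
  fixes q :: "nat \<Rightarrow> real" and f :: "real \<Rightarrow> real"
  assumes q: "strict_mono_on {..m} q" and "k \<le> l" "l \<le> m"
  shows "(\<Sum>j<m. indicator {q k<..q l} (q (Suc j)) * (f (q (Suc j)) - f (q j))) = f (q l) - f (q k)"
proof -
  have "(\<Sum>j<m. indicator {q k<..q l} (q (Suc j)) * (f (q (Suc j)) - f (q j))) =
      (\<Sum>j<m. if j \<in> {k..<l} then f (q (Suc j)) - f (q j) else 0)"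
  proof (intro sum.cong refl)
    fix j assume "j \<in> {..<m}"
    then have "q k < q (Suc j) \<longleftrightarrow> k < Suc j" "q (Suc j) \<le> q l \<longleftrightarrow> Suc j \<le> l"
      using strict_mono_on_less[OF q] strict_mono_on_less_eq[OF q] assms(2,3) by auto
    then show "indicator {q k<..q l} (q (Suc j)) * (f (q (Suc j)) - f (q j)) =
        (if j \<in> {k..<l} then f (q (Suc j)) - f (q j) else 0)"
      by (auto simp: indicator_def)
  qed
  also have "\<dots> = (\<Sum>j\<in>{k..<l}. f (q (Suc j)) - f (q j))"
    using assms(3) by (subst sum.inter_restrict[symmetric]) (auto intro!: sum.cong)
  also have "\<dots> = f (q l) - f (q k)"
    using assms(2) by (rule sum_Suc_diff')
  finally show ?thesis .
qed

context brownian_space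
begin

text \<open>On a finer grid, the coefficient of a cell is the value of the simple process at the right end
  point of the cell. It is measurable at the left end point, because an interval of the original
  partition that meets the cell begins no later than the cell does.\<close>

lemma simple_integrand_refine:
  assumes si: "simple_integrand M F T n p c"
    and q: "strict_mono_on {..m} q" "q ` {..m} \<subseteq> {0..T}" "p ` {..n} \<subseteq> q ` {..m}"
  defines "d \<equiv> \<lambda>j. simple_process n p c (q (Suc j))"
  shows "simple_integrand M F T m q d"
    and "simple_process m q d s \<omega> = simple_process n p c s \<omega>"
    and "simple_ito X m q d \<omega> = simple_ito X n p c \<omega>"
proof -
  obtain l where l: "\<And>i. i \<le> n \<Longrightarrow> l i \<le> m \<and> p i = q (l i)"
  proof -
    have "\<forall>i\<in>{..n}. \<exists>k\<in>{..m}. p i = q k" using q(3) by blast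
    then show ?thesis using that by (metis atMost_iff)
  qed
  note c = simple_integrand_coeff[OF si]
  have l_mono: "l i \<le> l (Suc i)" if "i < n" for i
    using l[of i] l[of "Suc i"] c(2)[OF that] that strict_mono_on_less_eq[OF q(1), of "l i" "l (Suc i)"] by auto
  have *: "(\<Sum>j<m. d j \<omega> * (f (q (Suc j)) - f (q j))) = (\<Sum>i<n. c i \<omega> * (f (p (Suc i)) - f (p i)))"
    for f :: "real \<Rightarrow> real"
  proof -
    have "(\<Sum>j<m. d j \<omega> * (f (q (Suc j)) - f (q j))) =
        (\<Sum>i<n. c i \<omega> * (\<Sum>j<m. indicator {p i<..p (Suc i)} (q (Suc j)) * (f (q (Suc j)) - f (q j))))"
      unfolding d_def simple_process_def sum_distrib_right sum_distrib_left
      by (subst sum.swap) (simp add: mult.assoc)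
    also have "\<dots> = (\<Sum>i<n. c i \<omega> * (f (p (Suc i)) - f (p i)))"
    proof (intro sum.cong refl)
      fix i assume "i \<in> {..<n}"
      then show "c i \<omega> * (\<Sum>j<m. indicator {p i<..p (Suc i)} (q (Suc j)) * (f (q (Suc j)) - f (q j))) =
          c i \<omega> * (f (p (Suc i)) - f (p i))"
        using grid_telescope[OF q(1) l_mono[of i], of f] l[of i] l[of "Suc i"] by simp
    qed
    finally show ?thesis .
  qed
  show "simple_ito X m q d \<omega> = simple_ito X n p c \<omega>"
    unfolding simple_ito_def using *[of "\<lambda>t. X t \<omega>"] .
  have ind: "indicator {a<..b} s = (if s \<le> b then 1 else 0) - (if s \<le> a then 1 else (0::real))"
    if "a \<le> b" for a b :: real
    using that by (auto simp: indicator_def)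
  have q_le: "q j \<le> q (Suc j)" if "j < m" for j
    using strict_mono_on_less_eq[OF q(1), of j "Suc j"] that by simp
  have "simple_process m q d s \<omega> = (\<Sum>j<m. d j \<omega> * ((if s \<le> q (Suc j) then 1 else 0) - (if s \<le> q j then 1 else 0)))"
    unfolding simple_process_def by (intro sum.cong refl) (simp add: ind[OF q_le])
  also have "\<dots> = (\<Sum>i<n. c i \<omega> * ((if s \<le> p (Suc i) then 1 else 0) - (if s \<le> p i then 1 else 0)))"
    by (rule *)
  also have "\<dots> = simple_process n p c s \<omega>"
    unfolding simple_process_def by (intro sum.cong refl) (simp add: ind[OF c(2)])
  finally show "simple_process m q d s \<omega> = simple_process n p c s \<omega>" .
  show "simple_integrand M F T m q d"
    unfolding simple_integrand_def
  proof (intro conjI allI impI)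
    show "q i \<in> {0..T}" if "i \<le> m" for i using q(2) that by auto
    show "q j \<le> q (Suc j)" if "j < m" for j using q_le[OF that] .
    fix j assume j: "j < m"
    have qj: "0 \<le> q j" "q j \<le> T" using q(2) j by (simp_all add: image_subset_iff)
    show "d j \<in> borel_measurable (F (q j))"
      unfolding d_def simple_process_def
    proof (intro borel_measurable_sum)
      fix i assume "i \<in> {..<n}"
      then have i: "i < n" by simp
      show "(\<lambda>\<omega>. c i \<omega> * indicator {p i<..p (Suc i)} (q (Suc j))) \<in> borel_measurable (F (q j))"
      proof (cases "p i < q (Suc j)")
        case True
        then have "l i < Suc j"
          using l[of i] i j strict_mono_on_less[OF q(1), of "l i" "Suc j"] by auto
        then have "p i \<le> q j"
          using l[of i] i j strict_mono_on_less_eq[OF q(1), of "l i" j] by auto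
        then have "c i \<in> borel_measurable (F (q j))"
          using c(1)[OF i] qj by (intro measurable_filtration_mono[OF c(4)[OF i]])
        then show ?thesis by (intro borel_measurable_times) auto
      qed simp
    qed
    have "\<exists>B. \<forall>i<n. \<forall>\<omega>\<in>space M. \<bar>c i \<omega>\<bar> \<le> B i"
      using c(5) by metis
    then obtain B where B: "\<And>i \<omega>. i < n \<Longrightarrow> \<omega> \<in> space M \<Longrightarrow> \<bar>c i \<omega>\<bar> \<le> B i" by auto
    have "\<bar>d j \<omega>\<bar> \<le> (\<Sum>i<n. B i)" if "\<omega> \<in> space M" for \<omega>
      unfolding d_def simple_process_def
    proof (rule order_trans[OF sum_abs], rule sum_mono)
      fix i assume "i \<in> {..<n}"
      with B[of i \<omega>] that show "\<bar>c i \<omega> * indicator {p i<..p (Suc i)} (q (Suc j))\<bar> \<le> B i"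
        by (auto simp: indicator_def)
    qed
    then show "\<exists>B. \<forall>\<omega>\<in>space M. \<bar>d j \<omega>\<bar> \<le> B" by blast
  qed
qed

text \<open>Both integrands are rewritten on the grid of all partition points, where they can be
  subtracted cell by cell.\<close>

lemma simple_integrand_diff:
  assumes si: "simple_integrand M F T n p c" and si': "simple_integrand M F T n' p' c'"
  obtains m q d where "simple_integrand M F T m q d"
    "\<And>s \<omega>. simple_process m q d s \<omega> = simple_process n p c s \<omega> - simple_process n' p' c' s \<omega>"
    "\<And>\<omega>. simple_ito X m q d \<omega> = simple_ito X n p c \<omega> - simple_ito X n' p' c' \<omega>"
proof -
  define Q where "Q = p ` {..n} \<union> p' ` {..n'}"
  define m where "m = card Q - 1"
  define q where "q = (!) (sorted_list_of_set Q)"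
  have fin: "finite Q" and ne: "Q \<noteq> {}" by (auto simp: Q_def)
  then have len: "length (sorted_list_of_set Q) = Suc m" by (simp add: m_def Suc_diff_1 card_gt_0_iff)
  have q: "strict_mono_on {..m} q"
    unfolding q_def
    using sorted_wrt_nth_less[OF strict_sorted_list_of_set[of Q]] len by (auto intro!: strict_mono_onI)
  have im: "q ` {..m} = Q"
  proof -
    have "q ` {..m} = set (sorted_list_of_set Q)"
      unfolding q_def set_conv_nth len by (auto simp: less_Suc_eq_le)
    then show ?thesis using fin by simp
  qed
  have sub: "q ` {..m} \<subseteq> {0..T}"
    unfolding im Q_def using si si' by (auto simp: simple_integrand_def)
  have "p ` {..n} \<subseteq> q ` {..m}" "p' ` {..n'} \<subseteq> q ` {..m}" by (auto simp: im Q_def)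
  note r = simple_integrand_refine[OF si q sub this(1)] and r' = simple_integrand_refine[OF si' q sub this(2)]
  let ?d = "\<lambda>j \<omega>. simple_process n p c (q (Suc j)) \<omega> - simple_process n' p' c' (q (Suc j)) \<omega>"
  show thesis
  proof (rule that[of m q ?d])
    show "simple_process m q ?d s \<omega> = simple_process n p c s \<omega> - simple_process n' p' c' s \<omega>" for s \<omega>
    proof -
      have "simple_process m q ?d s \<omega> =
          simple_process m q (\<lambda>j. simple_process n p c (q (Suc j))) s \<omega> -
          simple_process m q (\<lambda>j. simple_process n' p' c' (q (Suc j))) s \<omega>"
        by (simp add: simple_process_def[of m] sum_subtractf left_diff_distrib)
      then show ?thesis by (simp only: r(2) r'(2))
    qed
    show "simple_ito X m q ?d \<omega> = simple_ito X n p c \<omega> - simple_ito X n' p' c' \<omega>" for \<omega>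
    proof -
      have "simple_ito X m q ?d \<omega> =
          simple_ito X m q (\<lambda>j. simple_process n p c (q (Suc j))) \<omega> -
          simple_ito X m q (\<lambda>j. simple_process n' p' c' (q (Suc j))) \<omega>"
        by (simp add: simple_ito_def[of X m] sum_subtractf left_diff_distrib)
      then show ?thesis by (simp only: r(3) r'(3))
    qed
    show "simple_integrand M F T m q ?d"
      unfolding simple_integrand_def
    proof (intro conjI allI impI)
      show "q i \<in> {0..T}" if "i \<le> m" for i using sub that by auto
      fix j assume j: "j < m"
      note c = simple_integrand_coeff[OF r(1) j] and c' = simple_integrand_coeff[OF r'(1) j]
      show "q j \<le> q (Suc j)" by (rule c(2))
      show "?d j \<in> borel_measurable (F (q j))" using c(4) c'(4) by (intro borel_measurable_diff)
      obtain B B' where B: "\<And>\<omega>. \<omega> \<in> space M \<Longrightarrow> \<bar>simple_process n p c (q (Suc j)) \<omega>\<bar> \<le> B"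
        "\<And>\<omega>. \<omega> \<in> space M \<Longrightarrow> \<bar>simple_process n' p' c' (q (Suc j)) \<omega>\<bar> \<le> B'"
        using c(5) c'(5) by blast
      have "\<bar>?d j \<omega>\<bar> \<le> B + B'" if "\<omega> \<in> space M" for \<omega>
        using B[OF that] by linarith
      then show "\<exists>B. \<forall>\<omega>\<in>space M. \<bar>?d j \<omega>\<bar> \<le> B" by blast
    qed
  qed
qed

end

section \<open>Measurability in time and the energy of a process\<close>

text \<open>Extending a process by zero beyond the time interval turns integrals over that interval into
  integrals over the whole line, to which the measurability theorems for parameter integrals
  apply.\<close>

lemma measurable_process_extend:
  assumes "measurable_process M T v" "0 \<le> T"
  shows "(\<lambda>(\<omega>, s). indicator {0..T} s * v s \<omega>) \<in> borel_measurable (M \<Otimes>\<^sub>M lborel)"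
proof -
  \<comment> \<open>Measurability over the restricted time axis transfers to the line by projecting times to the interval.\<close>
  define cl where "cl s = max 0 (min T s)" for s :: real
  have cl: "cl \<in> borel \<rightarrow>\<^sub>M restrict_space borel {0..T}"
    unfolding cl_def using assms(2) by (intro measurable_restrict_space2) auto
  have "(\<lambda>(\<omega>, s). (\<omega>, cl s)) \<in> M \<Otimes>\<^sub>M lborel \<rightarrow>\<^sub>M M \<Otimes>\<^sub>M restrict_space borel {0..T}"
    unfolding case_prod_beta'
    by (intro measurable_Pair measurable_fst measurable_compose[OF measurable_snd])
      (use cl in simp)
  from measurable_compose[OF this, of "\<lambda>(\<omega>, s). v s \<omega>"]
  have [measurable]: "(\<lambda>(\<omega>, s). v (cl s) \<omega>) \<in> borel_measurable (M \<Otimes>\<^sub>M lborel)"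
    using assms(1) by (simp add: measurable_process_def case_prod_beta')
  have "(\<lambda>(\<omega>, s). indicator {0..T} s * v s \<omega>) = (\<lambda>(\<omega>, s). indicator {0..T} s * v (cl s) \<omega>)"
    by (auto simp: indicator_def cl_def fun_eq_iff)
  also have "\<dots> \<in> borel_measurable (M \<Otimes>\<^sub>M lborel)" by measurable
  finally show ?thesis .
qed

lemma measurable_process_path:
  assumes "measurable_process M T v" "0 \<le> T" "\<omega> \<in> space M"
  shows "(\<lambda>s. indicator {0..T} s * v s \<omega>) \<in> borel_measurable lborel"
  using measurable_Pair2[OF measurable_process_extend[OF assms(1,2)] assms(3)] by simp

lemma measurable_process_diff:
  assumes "measurable_process M T v" "measurable_process M T w"
  shows "measurable_process M T (\<lambda>s \<omega>. v s \<omega> - w s \<omega>)"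
  using borel_measurable_diff[OF assms[unfolded measurable_process_def]]
  by (simp add: measurable_process_def case_prod_beta')

lemma measurable_process_deterministic:
  assumes "g \<in> borel_measurable borel"
  shows "measurable_process M T (\<lambda>s \<omega>. g s)"
proof -
  have "g \<in> borel_measurable (restrict_space borel {0..T})"
    using assms by (rule measurable_restrict_space1)
  from measurable_compose[OF measurable_snd this] show ?thesis
    by (simp add: measurable_process_def case_prod_beta')
qed

definition time_energy :: "real \<Rightarrow> (real \<Rightarrow> 'a \<Rightarrow> real) \<Rightarrow> 'a \<Rightarrow> ennreal" where
  "time_energy T v \<omega> = (\<integral>\<^sup>+ s\<in>{0..T}. ennreal ((v s \<omega>)\<^sup>2) \<partial>lborel)"

lemma time_energy_extend:
  "time_energy T v \<omega> = (\<integral>\<^sup>+ s. ennreal ((indicator {0..T} s * v s \<omega>)\<^sup>2) \<partial>lborel)"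
  unfolding time_energy_def by (intro nn_integral_cong) (auto simp: indicator_def)

lemma measurable_time_energy:
  assumes "measurable_process M T v" "0 \<le> T"
  shows "time_energy T v \<in> borel_measurable M"
proof -
  note [measurable] = measurable_process_extend[OF assms]
  have "(\<lambda>(\<omega>, s). ennreal ((indicator {0..T} s * v s \<omega>)\<^sup>2)) =
      (\<lambda>x. ennreal (((\<lambda>(\<omega>, s). indicator {0..T} s * v s \<omega>) x)\<^sup>2))" by auto
  also have "\<dots> \<in> borel_measurable (M \<Otimes>\<^sub>M lborel)" by measurable
  finally show ?thesis
    unfolding time_energy_extend[abs_def] by (rule lborel.borel_measurable_nn_integral)
qed

lemma time_energy_diff_le:
  assumes "measurable_process M T v" "measurable_process M T w" "0 \<le> T" "\<omega> \<in> space M"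
  shows "time_energy T (\<lambda>s \<omega>. v s \<omega> - w s \<omega>) \<omega> \<le> 2 * time_energy T v \<omega> + 2 * time_energy T w \<omega>"
proof -
  note [measurable] = measurable_process_path[OF assms(1,3,4)] measurable_process_path[OF assms(2,3,4)]
  have "time_energy T (\<lambda>s \<omega>. v s \<omega> - w s \<omega>) \<omega> \<le>
      (\<integral>\<^sup>+ s. 2 * ennreal ((indicator {0..T} s * v s \<omega>)\<^sup>2) + 2 * ennreal ((indicator {0..T} s * w s \<omega>)\<^sup>2) \<partial>lborel)"
    unfolding time_energy_extend
  proof (rule nn_integral_mono)
    fix s
    have "(a - b)\<^sup>2 \<le> 2 * a\<^sup>2 + 2 * b\<^sup>2" for a b :: real
      using zero_le_power2[of "a + b"] by (simp add: power2_eq_square algebra_simps)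
    from this[of "indicator {0..T} s * v s \<omega>" "indicator {0..T} s * w s \<omega>"]
    have "(indicator {0..T} s * (v s \<omega> - w s \<omega>))\<^sup>2 \<le>
        2 * (indicator {0..T} s * v s \<omega>)\<^sup>2 + 2 * (indicator {0..T} s * w s \<omega>)\<^sup>2"
      by (simp add: right_diff_distrib)
    then have "ennreal ((indicator {0..T} s * (v s \<omega> - w s \<omega>))\<^sup>2) \<le>
        ennreal (2 * (indicator {0..T} s * v s \<omega>)\<^sup>2 + 2 * (indicator {0..T} s * w s \<omega>)\<^sup>2)"
      by (rule ennreal_leI)
    also have "\<dots> = 2 * ennreal ((indicator {0..T} s * v s \<omega>)\<^sup>2) + 2 * ennreal ((indicator {0..T} s * w s \<omega>)\<^sup>2)"
      by (simp add: ennreal_plus ennreal_mult)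
    finally show "ennreal ((indicator {0..T} s * (v s \<omega> - w s \<omega>))\<^sup>2) \<le> \<dots>" .
  qed
  also have "\<dots> = 2 * time_energy T v \<omega> + 2 * time_energy T w \<omega>"
    unfolding time_energy_extend by (subst nn_integral_add) (auto simp: nn_integral_cmult)
  finally show ?thesis .
qed

lemma (in prob_space) prob_tendsto_0_subset_Un:
  assumes "\<And>k. B k \<in> events" "\<And>k. C k \<in> events" "\<And>k. A k \<subseteq> B k \<union> C k"
    and "(\<lambda>k. prob (B k)) \<longlonglongrightarrow> 0" "(\<lambda>k. prob (C k)) \<longlonglongrightarrow> 0"
  shows "(\<lambda>k. prob (A k)) \<longlonglongrightarrow> 0"
proof (rule tendsto_sandwich[OF _ _ tendsto_const tendsto_add_zero[OF assms(4,5)]])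
  show "\<forall>\<^sub>F k in sequentially. prob (A k) \<le> prob (B k) + prob (C k)"
  proof (intro always_eventually allI)
    fix k
    have "prob (A k) \<le> prob (B k \<union> C k)" using assms(1-3) by (intro finite_measure_mono) auto
    also have "\<dots> \<le> prob (B k) + prob (C k)" using assms(1,2) by (rule measure_Un_le)
    finally show "prob (A k) \<le> prob (B k) + prob (C k)" .
  qed
qed simp

section \<open>Linearity and uniqueness of the Ito integral\<close>

context brownian_space
begin

lemma measurable_simple_process:
  assumes "simple_integrand M F T n p c"
  shows "measurable_process M T (simple_process n p c)"
proof -
  have "(\<lambda>x. c i (fst x) * indicator {p i<..p (Suc i)} (snd x))
      \<in> borel_measurable (M \<Otimes>\<^sub>M restrict_space borel {0..T})" if "i < n" for i
  proof (rule borel_measurable_times)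
    show "(\<lambda>x. c i (fst x)) \<in> borel_measurable (M \<Otimes>\<^sub>M restrict_space borel {0..T})"
      by (rule measurable_compose[OF measurable_fst simple_integrand_coeff(6)[OF assms that]])
    have "indicator {p i<..p (Suc i)} \<in> borel_measurable (restrict_space borel {0..T})"
      by (rule measurable_restrict_space1) simp
    then show "(\<lambda>x. indicator {p i<..p (Suc i)} (snd x)) \<in> borel_measurable (M \<Otimes>\<^sub>M restrict_space borel {0..T})"
      by (rule measurable_compose[OF measurable_snd])
  qed
  then show ?thesis
    unfolding measurable_process_def simple_process_def case_prod_beta'
    by (intro borel_measurable_sum) auto
qed

lemma measurable_simple_ito:
  assumes "simple_integrand M F T n p c"
  shows "simple_ito X n p c \<in> borel_measurable M"
  using simple_ito_isometry[OF assms] measurable_filtration simple_integrand_point[OF assms, of n] by auto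

text \<open>The squared difference of two functions is at most twice the sum of their squares, so the
  tolerance is split into quarters for the energies and into halves for the integrals.\<close>

lemma ito_integral_diff:
  assumes "0 \<le> T" and v: "measurable_process M T v" and v': "measurable_process M T v'"
    and J: "ito_integral M F T X v J" and J': "ito_integral M F T X v' J'"
  shows "ito_integral M F T X (\<lambda>s \<omega>. v s \<omega> - v' s \<omega>) (\<lambda>\<omega>. J \<omega> - J' \<omega>)"
proof -
  from J obtain n p c where si: "\<And>k. simple_integrand M F T (n k) (p k) (c k)"
    and Jm: "J \<in> borel_measurable M"
    and conv: "\<And>\<epsilon>. 0 < \<epsilon> \<Longrightarrow> (\<lambda>k. prob {\<omega> \<in> space M.
            time_energy T (\<lambda>s \<omega>. simple_process (n k) (p k) (c k) s \<omega> - v s \<omega>) \<omega> > ennreal \<epsilon>}) \<longlonglongrightarrow> 0"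
      "\<And>\<epsilon>. 0 < \<epsilon> \<Longrightarrow> (\<lambda>k. prob {\<omega> \<in> space M. \<bar>simple_ito X (n k) (p k) (c k) \<omega> - J \<omega>\<bar> > \<epsilon>}) \<longlonglongrightarrow> 0"
    unfolding ito_integral_def time_energy_def by blast
  from J' obtain n' p' c' where si': "\<And>k. simple_integrand M F T (n' k) (p' k) (c' k)"
    and Jm': "J' \<in> borel_measurable M"
    and conv': "\<And>\<epsilon>. 0 < \<epsilon> \<Longrightarrow> (\<lambda>k. prob {\<omega> \<in> space M.
            time_energy T (\<lambda>s \<omega>. simple_process (n' k) (p' k) (c' k) s \<omega> - v' s \<omega>) \<omega> > ennreal \<epsilon>}) \<longlonglongrightarrow> 0"
      "\<And>\<epsilon>. 0 < \<epsilon> \<Longrightarrow> (\<lambda>k. prob {\<omega> \<in> space M. \<bar>simple_ito X (n' k) (p' k) (c' k) \<omega> - J' \<omega>\<bar> > \<epsilon>}) \<longlonglongrightarrow> 0"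
    unfolding ito_integral_def time_energy_def by blast
  have "\<exists>m q d. simple_integrand M F T m q d \<and>
      (\<forall>s \<omega>. simple_process m q d s \<omega> =
        simple_process (n k) (p k) (c k) s \<omega> - simple_process (n' k) (p' k) (c' k) s \<omega>) \<and>
      (\<forall>\<omega>. simple_ito X m q d \<omega> = simple_ito X (n k) (p k) (c k) \<omega> - simple_ito X (n' k) (p' k) (c' k) \<omega>)" for k
    by (rule simple_integrand_diff[OF si[of k] si'[of k]]) blast
  then obtain m q d where d: "\<And>k. simple_integrand M F T (m k) (q k) (d k)"
    and sp: "\<And>k s \<omega>. simple_process (m k) (q k) (d k) s \<omega> =
        simple_process (n k) (p k) (c k) s \<omega> - simple_process (n' k) (p' k) (c' k) s \<omega>"
    and ito: "\<And>k \<omega>. simple_ito X (m k) (q k) (d k) \<omega> =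
        simple_ito X (n k) (p k) (c k) \<omega> - simple_ito X (n' k) (p' k) (c' k) \<omega>"
    by metis
  note [measurable] = Jm Jm' measurable_simple_ito[OF si] measurable_simple_ito[OF si']
  let ?e = "\<lambda>k s \<omega>. simple_process (n k) (p k) (c k) s \<omega> - v s \<omega>"
    and ?e' = "\<lambda>k s \<omega>. simple_process (n' k) (p' k) (c' k) s \<omega> - v' s \<omega>"
  have em: "measurable_process M T (?e k)" "measurable_process M T (?e' k)" for k
    by (intro measurable_process_diff measurable_simple_process si si' v v')+
  note [measurable] = measurable_time_energy[OF em(1) \<open>0 \<le> T\<close>] measurable_time_energy[OF em(2) \<open>0 \<le> T\<close>]
  have energy: "(\<lambda>k. prob {\<omega> \<in> space M. time_energy T
        (\<lambda>s \<omega>. simple_process (m k) (q k) (d k) s \<omega> - (v s \<omega> - v' s \<omega>)) \<omega> > ennreal \<epsilon>}) \<longlonglongrightarrow> 0" if \<epsilon>: "0 < \<epsilon>" for \<epsilon>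
    proof (rule prob_tendsto_0_subset_Un[OF _ _ _ conv(1)[of "\<epsilon> / 4"] conv'(1)[of "\<epsilon> / 4"]])
      fix k
      show "{\<omega> \<in> space M. time_energy T
          (\<lambda>s \<omega>. simple_process (m k) (q k) (d k) s \<omega> - (v s \<omega> - v' s \<omega>)) \<omega> > ennreal \<epsilon>} \<subseteq>
          {\<omega> \<in> space M. time_energy T (?e k) \<omega> > ennreal (\<epsilon> / 4)} \<union>
          {\<omega> \<in> space M. time_energy T (?e' k) \<omega> > ennreal (\<epsilon> / 4)}"
      proof (rule subsetI, rule ccontr)
        fix \<omega> assume "\<omega> \<in> {\<omega> \<in> space M. time_energy T
          (\<lambda>s \<omega>. simple_process (m k) (q k) (d k) s \<omega> - (v s \<omega> - v' s \<omega>)) \<omega> > ennreal \<epsilon>}"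
          "\<omega> \<notin> {\<omega> \<in> space M. time_energy T (?e k) \<omega> > ennreal (\<epsilon> / 4)} \<union>
          {\<omega> \<in> space M. time_energy T (?e' k) \<omega> > ennreal (\<epsilon> / 4)}"
        then have w: "\<omega> \<in> space M" and
          gt: "time_energy T (\<lambda>s \<omega>. ?e k s \<omega> - ?e' k s \<omega>) \<omega> > ennreal \<epsilon>" and
          le: "time_energy T (?e k) \<omega> \<le> ennreal (\<epsilon> / 4)" "time_energy T (?e' k) \<omega> \<le> ennreal (\<epsilon> / 4)"
          by (auto simp: sp algebra_simps not_less)
        have "time_energy T (\<lambda>s \<omega>. ?e k s \<omega> - ?e' k s \<omega>) \<omega> \<le> 2 * time_energy T (?e k) \<omega> + 2 * time_energy T (?e' k) \<omega>"
          by (rule time_energy_diff_le[OF em \<open>0 \<le> T\<close> w])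
        also have "\<dots> \<le> 2 * ennreal (\<epsilon> / 4) + 2 * ennreal (\<epsilon> / 4)"
          by (intro add_mono mult_left_mono le) auto
        also have "2 * ennreal (\<epsilon> / 4) = ennreal (\<epsilon> / 2)"
          using ennreal_mult[of 2 "\<epsilon> / 4"] \<epsilon> by simp
        also have "ennreal (\<epsilon> / 2) + ennreal (\<epsilon> / 2) = ennreal \<epsilon>"
          using \<epsilon> by (simp flip: ennreal_plus)
        finally show False using gt by simp
      qed
    qed (use \<epsilon> in \<open>auto\<close>)
  have "(\<lambda>k. prob {\<omega> \<in> space M. \<bar>simple_ito X (m k) (q k) (d k) \<omega> - (J \<omega> - J' \<omega>)\<bar> > \<epsilon>}) \<longlonglongrightarrow> 0"
    if \<epsilon>: "0 < \<epsilon>" for \<epsilon>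
      by (rule prob_tendsto_0_subset_Un[OF _ _ _ conv(2)[of "\<epsilon> / 2"] conv'(2)[of "\<epsilon> / 2"]])
        (use \<epsilon> in \<open>auto simp: ito abs_if not_less split: if_splits\<close>)
  with d energy show ?thesis
    unfolding ito_integral_def time_energy_def
    by (intro conjI exI[of _ m] exI[of _ q] exI[of _ d] allI impI) (auto intro: borel_measurable_diff)
qed

text \<open>With \<open>v\<close> equal to zero, the approximating simple integrands have energies that tend to zero in
  probability. By \<open>simple_ito_tail\<close> their integrals then tend to zero in probability, so their limit
  \<open>J\<close> is zero. Together with \<open>ito_integral_diff\<close> this makes the integral independent of the
  approximating sequence.\<close>

lemma ito_integral_unique_0:
  assumes "0 \<le> T" and v: "measurable_process M T v" and J: "ito_integral M F T X v J"
    and zero: "AE \<omega> in M. AE s in lborel. s \<in> {0..T} \<longrightarrow> v s \<omega> = 0"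
  shows "AE \<omega> in M. J \<omega> = 0"
proof -
  from J obtain n p c where si: "\<And>k. simple_integrand M F T (n k) (p k) (c k)"
    and [measurable]: "J \<in> borel_measurable M"
    and conv: "\<And>\<epsilon>. 0 < \<epsilon> \<Longrightarrow> (\<lambda>k. prob {\<omega> \<in> space M.
            time_energy T (\<lambda>s \<omega>. simple_process (n k) (p k) (c k) s \<omega> - v s \<omega>) \<omega> > ennreal \<epsilon>}) \<longlonglongrightarrow> 0"
      "\<And>\<epsilon>. 0 < \<epsilon> \<Longrightarrow> (\<lambda>k. prob {\<omega> \<in> space M. \<bar>simple_ito X (n k) (p k) (c k) \<omega> - J \<omega>\<bar> > \<epsilon>}) \<longlonglongrightarrow> 0"
    unfolding ito_integral_def time_energy_def by blast
  let ?S = "\<lambda>k. simple_process (n k) (p k) (c k)" and ?I = "\<lambda>k. simple_ito X (n k) (p k) (c k)"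
  note [measurable] = measurable_simple_ito[OF si] measurable_time_energy[OF measurable_simple_process[OF si] \<open>0 \<le> T\<close>]
    measurable_time_energy[OF measurable_process_diff[OF measurable_simple_process[OF si] v] \<open>0 \<le> T\<close>]
  have energy: "AE \<omega> in M. time_energy T (\<lambda>s \<omega>. ?S k s \<omega> - v s \<omega>) \<omega> = time_energy T (?S k) \<omega>" for k
    using zero
  proof eventually_elim
    case (elim \<omega>)
    then show ?case
      unfolding time_energy_def by (intro nn_integral_cong_AE) (auto simp: indicator_def elim: eventually_mono)
  qed
  have small: "prob {\<omega> \<in> space M. \<bar>J \<omega>\<bar> > 2 * \<epsilon>} \<le> \<delta> / \<epsilon>\<^sup>2" if \<epsilon>: "0 < \<epsilon>" and \<delta>: "0 < \<delta>" for \<epsilon> \<delta>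
  proof (rule LIMSEQ_le_const)
    let ?b = "\<lambda>k. prob {\<omega> \<in> space M. \<bar>?I k \<omega> - J \<omega>\<bar> > \<epsilon>} +
      (prob {\<omega> \<in> space M. time_energy T (\<lambda>s \<omega>. ?S k s \<omega> - v s \<omega>) \<omega> > ennreal \<delta>} + \<delta> / \<epsilon>\<^sup>2)"
    show "?b \<longlonglongrightarrow> \<delta> / \<epsilon>\<^sup>2"
      using tendsto_add[OF conv(2)[OF \<epsilon>] tendsto_add[OF conv(1)[OF \<delta>] tendsto_const]] by simp
    show "\<exists>N. \<forall>k\<ge>N. prob {\<omega> \<in> space M. \<bar>J \<omega>\<bar> > 2 * \<epsilon>} \<le> ?b k"
    proof (intro exI[of _ 0] allI impI)
      fix k
      have "prob {\<omega> \<in> space M. \<bar>J \<omega>\<bar> > 2 * \<epsilon>} \<le>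
          prob ({\<omega> \<in> space M. \<bar>?I k \<omega> - J \<omega>\<bar> > \<epsilon>} \<union> {\<omega> \<in> space M. \<bar>?I k \<omega>\<bar> > \<epsilon>})"
        by (intro finite_measure_mono) auto
      also have "\<dots> \<le> prob {\<omega> \<in> space M. \<bar>?I k \<omega> - J \<omega>\<bar> > \<epsilon>} + prob {\<omega> \<in> space M. \<bar>?I k \<omega>\<bar> > \<epsilon>}"
        by (intro measure_Un_le) measurable
      also have "prob {\<omega> \<in> space M. \<bar>?I k \<omega>\<bar> > \<epsilon>} \<le>
          prob {\<omega> \<in> space M. (\<Sum>i<n k. (c k i \<omega>)\<^sup>2 * (p k (Suc i) - p k i)) > \<delta>} + \<delta> / \<epsilon>\<^sup>2"
        using simple_ito_tail[OF si[of k] \<epsilon>] \<delta> by simp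
      also have "{\<omega> \<in> space M. (\<Sum>i<n k. (c k i \<omega>)\<^sup>2 * (p k (Suc i) - p k i)) > \<delta>} =
          {\<omega> \<in> space M. time_energy T (?S k) \<omega> > ennreal \<delta>}"
      proof -
        have "time_energy T (?S k) \<omega> = ennreal (\<Sum>i<n k. (c k i \<omega>)\<^sup>2 * (p k (Suc i) - p k i))" for \<omega>
          unfolding time_energy_def
          using simple_integrand_mono[OF si[of k]] simple_integrand_point[OF si[of k]]
          by (intro nn_integral_simple_process) auto
        then show ?thesis using \<delta> by (simp add: ennreal_less_iff)
      qed
      also have "prob \<dots> = prob {\<omega> \<in> space M. time_energy T (\<lambda>s \<omega>. ?S k s \<omega> - v s \<omega>) \<omega> > ennreal \<delta>}"
        using energy[of k] by (intro finite_measure_eq_AE) (auto elim: eventually_mono)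
      finally show "prob {\<omega> \<in> space M. \<bar>J \<omega>\<bar> > 2 * \<epsilon>} \<le> ?b k" by simp
    qed
  qed
  have "AE \<omega> in M. \<bar>J \<omega>\<bar> \<le> 2 * \<epsilon>" if \<epsilon>: "0 < \<epsilon>" for \<epsilon>
  proof -
    have "prob {\<omega> \<in> space M. \<bar>J \<omega>\<bar> > 2 * \<epsilon>} \<le> 0 + e" if "0 < e" for e
      using small[OF \<epsilon>, of "e * \<epsilon>\<^sup>2"] \<epsilon> that by simp
    then have "prob {\<omega> \<in> space M. \<bar>J \<omega>\<bar> > 2 * \<epsilon>} = 0"
      using field_le_epsilon[of "prob {\<omega> \<in> space M. \<bar>J \<omega>\<bar> > 2 * \<epsilon>}" 0] by (simp add: measure_le_0_iff)
    then show ?thesis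
      by (subst (asm) prob_eq_0) (auto simp: not_less)
  qed
  then have "AE \<omega> in M. \<forall>i::nat. \<bar>J \<omega>\<bar> \<le> 2 * inverse (real (Suc i))"
    by (subst AE_all_countable) simp
  then show ?thesis
  proof eventually_elim
    case (elim \<omega>)
    show ?case
    proof (rule ccontr)
      assume "J \<omega> \<noteq> 0"
      then obtain i where "inverse (real (Suc i)) < \<bar>J \<omega>\<bar> / 2"
        using reals_Archimedean[of "\<bar>J \<omega>\<bar> / 2"] by auto
      with elim show False by (auto simp: not_le[symmetric] dest: spec[of _ i])
    qed
  qed
qed

lemma ito_integral_indicator:
  assumes "0 \<le> a" "a \<le> b" "b \<le> T"
  shows "ito_integral M F T X (\<lambda>s \<omega>. indicator {a<..b} s) (\<lambda>\<omega>. X b \<omega> - X a \<omega>)"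
proof -
  define p where "p i = (if i = 0 then a else b)" for i :: nat
  have si: "simple_integrand M F T 1 p (\<lambda>i \<omega>. 1)"
    using assms by (auto simp: simple_integrand_def p_def)
  have sp: "simple_process 1 p (\<lambda>i \<omega>. 1) s \<omega> = indicator {a<..b} s" for s and \<omega> :: 'a
    by (simp add: simple_process_def p_def)
  have ito: "simple_ito X 1 p (\<lambda>i \<omega>. 1) \<omega> = X b \<omega> - X a \<omega>" for \<omega>
    by (simp add: simple_ito_def p_def)
  show ?thesis
    unfolding ito_integral_def
    by (intro conjI exI[of _ "\<lambda>k. 1"] exI[of _ "\<lambda>k. p"] exI[of _ "\<lambda>k i \<omega>. 1"] allI impI borel_measurable_diff
        process_measurable) (use assms si sp ito in auto)
qed

end

section \<open>Paths with square integrable derivative\<close>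

text \<open>The half lines \<open>{..r}\<close> form an intersection-stable generator of the Borel sets, so the integral
  of \<open>f\<close> vanishes over every Borel set.\<close>

lemma AE_eq_0_if_integral_atMost_eq_0:
  fixes f :: "real \<Rightarrow> real"
  assumes f: "integrable lborel f" and zero: "\<And>r. (LINT s:{..r}|lborel. f s) = 0"
  shows "AE s in lborel. f s = 0"
proof (rule density_unique_real[OF f integrable_zero])
  have int: "set_integrable lborel A f" if "A \<in> sets borel" for A
    using integrable_mult_indicator[of A lborel f] f that by (simp add: set_integrable_def)
  \<comment> \<open>The whole line is not a half line; its integral is a limit of vanishing ones.\<close>
  have "(\<lambda>i::nat. LINT s:{..real i}|lborel. f s) \<longlonglongrightarrow> (LINT s:(\<Union>i::nat. {..real i})|lborel. f s)"
    by (rule set_integral_cont_up) (auto simp: incseq_def int)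
  also have "(\<Union>i::nat. {..real i}) = (UNIV :: real set)"
    using real_arch_simple by auto
  finally have univ: "(LINT s:UNIV|lborel. f s) = 0"
    unfolding zero by (simp add: LIMSEQ_const_iff)
  fix A :: "real set" assume "A \<in> sets lborel"
  then have "A \<in> sets borel" by simp
  then have A: "A \<in> sigma_sets UNIV (range (\<lambda>r. {..r}))"
    unfolding borel_eq_atMost by simp
  have "Int_stable (range (\<lambda>r::real. {..r}))" "range (\<lambda>r::real. {..r}) \<subseteq> Pow UNIV"
    by (auto simp: Int_stable_def)
  from this A have "(LINT s:A|lborel. f s) = 0"
  proof (induction rule: sigma_sets_induct_disjoint)
    case (compl A)
    then have A: "A \<in> sets borel" by (simp add: borel_eq_atMost)
    have "(LINT s:(UNIV - A) \<union> A|lborel. f s) = (LINT s:UNIV - A|lborel. f s) + (LINT s:A|lborel. f s)"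
      using A by (intro set_integral_Un int) auto
    then show ?case using compl univ by (simp add: Un_absorb2)
  next
    case (union A)
    have A: "A i \<in> sets borel" for i using union(2) by (auto simp: borel_eq_atMost)
    then have "(LINT s:(\<Union>i. A i)|lborel. f s) = (\<Sum>i. LINT s:A i|lborel. f s)"
      using union(1) by (intro lebesgue_integral_countable_add int) (auto simp: disjoint_family_on_def)
    then show ?case using union(3) by simp
  qed (auto simp: zero set_lebesgue_integral_def[of _ "{}"])
  then show "(LINT s:A|lborel. f s) = (LINT s:A|lborel. 0)" by simp
qed

lemma set_integral_indicator_Int:
  fixes f :: "'a \<Rightarrow> real"
  shows "(LINT x:A|M. indicator B x * f x) = (LINT x:A \<inter> B|M. f x)"
  unfolding set_lebesgue_integral_def by (intro Bochner_Integration.integral_cong) (auto simp: indicator_def)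

lemma h1_derivative_integrable:
  assumes "h1_derivative T h g"
  shows "set_integrable lborel {0..T} g"
proof -
  have g: "set_borel_measurable lborel {0..T} g" and g2: "set_integrable lborel {0..T} (\<lambda>s. (g s)\<^sup>2)"
    using assms by (auto simp: h1_derivative_def)
  have "set_integrable lborel {0..T} (\<lambda>s. 1 + (g s)\<^sup>2)"
    using g2 by (intro set_integral_add)
      (auto simp: set_integrable_def emeasure_lborel_Icc_eq intro!: integrable_real_indicator)
  then show ?thesis
    unfolding set_integrable_def
  proof (rule Bochner_Integration.integrable_bound)
    have le: "\<bar>x\<bar> \<le> 1 + x\<^sup>2" for x :: real
      using zero_le_power2[of "\<bar>x\<bar> - 1"] zero_le_power2[of x] by (simp add: power2_diff)
    show "AE s in lborel. norm (indicator {0..T} s *\<^sub>R g s) \<le> norm (indicator {0..T} s *\<^sub>R (1 + (g s)\<^sup>2))"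
      using le by (intro AE_I2) (auto simp: indicator_def intro: order_trans)
  qed (use g in \<open>simp add: set_borel_measurable_def\<close>)
qed

lemma h1_derivative_increment:
  assumes g: "h1_derivative T h g" and "0 \<le> a" "a \<le> b" "b \<le> T"
  shows "h b - h a = (LINT s:{a<..b}|lborel. g s)"
proof -
  have int: "set_integrable lborel A g" if "A \<in> sets borel" "A \<subseteq> {0..T}" for A
    by (rule set_integrable_subset[OF h1_derivative_integrable[OF g]]) (use that in auto)
  have "{0..b} = {0..a} \<union> {a<..b}" using assms by auto
  then have "(LINT s:{0..b}|lborel. g s) = (LINT s:{0..a}|lborel. g s) + (LINT s:{a<..b}|lborel. g s)"
    using assms by (simp only:, intro set_integral_Un int) auto
  then show ?thesis using assms by (simp add: h1_derivative_def)
qed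

lemma h1_derivative_add:
  assumes f: "h1_derivative T h f" and g: "h1_derivative T k g"
  shows "h1_derivative T (\<lambda>t. h t + k t) (\<lambda>s. f s + g s)"
  unfolding h1_derivative_def
proof (intro conjI ballI)
  have m: "set_borel_measurable lborel {0..T} f" "set_borel_measurable lborel {0..T} g"
    using f g by (auto simp: h1_derivative_def)
  then have m': "set_borel_measurable lborel {0..T} (\<lambda>s. f s + g s)"
    using borel_measurable_add[OF m[unfolded set_borel_measurable_def]]
    by (simp add: set_borel_measurable_def distrib_left)
  then show "set_borel_measurable lborel {0..T} (\<lambda>s. f s + g s)" .
  have sq: "set_integrable lborel {0..T} (\<lambda>s. 2 * (f s)\<^sup>2 + 2 * (g s)\<^sup>2)"
    using f g by (intro set_integral_add) (auto simp: h1_derivative_def)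
  show "set_integrable lborel {0..T} (\<lambda>s. (f s + g s)\<^sup>2)"
    unfolding set_integrable_def
  proof (rule Bochner_Integration.integrable_bound[OF sq[unfolded set_integrable_def]])
    have le: "(x + y)\<^sup>2 \<le> 2 * x\<^sup>2 + 2 * y\<^sup>2" for x y :: real
      using zero_le_power2[of "x - y"] by (simp add: power2_eq_square algebra_simps)
    show "AE s in lborel. norm (indicator {0..T} s *\<^sub>R (f s + g s)\<^sup>2) \<le>
        norm (indicator {0..T} s *\<^sub>R (2 * (f s)\<^sup>2 + 2 * (g s)\<^sup>2))"
      using le by (intro AE_I2) (auto simp: indicator_def)
    have "(\<lambda>s. (indicator {0..T} s *\<^sub>R (f s + g s))\<^sup>2) \<in> borel_measurable lborel"
      using m' unfolding set_borel_measurable_def by (rule borel_measurable_power)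
    also have "(\<lambda>s. (indicator {0..T} s *\<^sub>R (f s + g s))\<^sup>2) = (\<lambda>s. indicator {0..T} s *\<^sub>R (f s + g s)\<^sup>2)"
      by (auto simp: indicator_def)
    finally show "(\<lambda>s. indicator {0..T} s *\<^sub>R (f s + g s)\<^sup>2) \<in> borel_measurable lborel" .
  qed
  fix t assume t: "t \<in> {0..T}"
  have int: "set_integrable lborel {0..t} f" "set_integrable lborel {0..t} g"
    using t by (auto intro: set_integrable_subset[OF h1_derivative_integrable[OF f]]
        set_integrable_subset[OF h1_derivative_integrable[OF g]])
  show "h t + k t = (LINT s:{0..t}|lborel. f s + g s)"
    using f g t by (simp add: set_integral_add[OF int] h1_derivative_def)
qed

lemma h1_derivative_unique:
  assumes f: "h1_derivative T h f" and g: "h1_derivative T k g" and eq: "\<And>t. t \<in> {0..T} \<Longrightarrow> h t = k t"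
  shows "AE s in lborel. s \<in> {0..T} \<longrightarrow> f s = g s"
proof -
  let ?w = "\<lambda>s. indicator {0..T} s * (f s - g s)"
  have "set_integrable lborel {0..T} (\<lambda>s. f s - g s)"
    by (intro set_integral_diff h1_derivative_integrable[OF f] h1_derivative_integrable[OF g])
  then have w: "integrable lborel ?w" by (simp add: set_integrable_def)
  have "AE s in lborel. ?w s = 0"
  proof (rule AE_eq_0_if_integral_atMost_eq_0[OF w])
    fix r
    have eq0: "(LINT s:{0..t}|lborel. f s - g s) = 0" if t: "t \<in> {0..T}" for t
    proof -
      have int: "set_integrable lborel {0..t} f" "set_integrable lborel {0..t} g"
        using t by (auto intro: set_integrable_subset[OF h1_derivative_integrable[OF f]]
            set_integrable_subset[OF h1_derivative_integrable[OF g]])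
      then have "(LINT s:{0..t}|lborel. f s - g s) = h t - k t"
        using f g t by (simp add: set_integral_diff h1_derivative_def)
      then show ?thesis using eq[OF t] by simp
    qed
    have "(LINT s:{..r}|lborel. ?w s) = (LINT s:{0..min r T}|lborel. f s - g s)"
      unfolding set_integral_indicator_Int by (rule arg_cong[where f="\<lambda>A. LINT s:A|lborel. f s - g s"]) auto
    also have "\<dots> = 0"
    proof (cases "0 \<le> r \<and> 0 \<le> T")
      case False
      then have "{0..min r T} = {}" by auto
      then show ?thesis by (simp add: set_lebesgue_integral_def)
    qed (intro eq0, auto)
    finally show "(LINT s:{..r}|lborel. ?w s) = 0" .
  qed
  then show ?thesis by eventually_elim (auto simp: indicator_def)
qed

text \<open>The Cauchy-Schwarz inequality against the constant function, in the form that the variance of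
  \<open>g\<close> over the interval is nonnegative.\<close>

lemma square_set_integral_le:
  fixes g :: "real \<Rightarrow> real"
  assumes "a < b" and g: "set_integrable lborel {a<..b} g" and g2: "set_integrable lborel {a<..b} (\<lambda>s. (g s)\<^sup>2)"
  shows "(LINT s:{a<..b}|lborel. g s)\<^sup>2 \<le> (b - a) * (LINT s:{a<..b}|lborel. (g s)\<^sup>2)"
proof -
  define m where "m = (LINT s:{a<..b}|lborel. g s) / (b - a)"
  have mean: "(LINT s:{a<..b}|lborel. g s) = m * (b - a)" using \<open>a < b\<close> by (simp add: m_def)
  have c: "set_integrable lborel {a<..b} (\<lambda>s. x)" and ci: "(LINT s:{a<..b}|lborel. x) = x * (b - a)" for x :: real
    using \<open>a < b\<close> by (auto simp: set_integrable_def set_lebesgue_integral_def)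
  have "0 \<le> (LINT s:{a<..b}|lborel. (g s - m)\<^sup>2)"
    unfolding set_lebesgue_integral_def by (intro Bochner_Integration.integral_nonneg) auto
  also have "(LINT s:{a<..b}|lborel. (g s - m)\<^sup>2) = (LINT s:{a<..b}|lborel. (g s)\<^sup>2 - 2 * m * g s + m\<^sup>2)"
    by (simp add: power2_diff algebra_simps)
  also have "\<dots> = (LINT s:{a<..b}|lborel. (g s)\<^sup>2) - 2 * m * (m * (b - a)) + m\<^sup>2 * (b - a)"
    using g g2 c by (simp add: set_integral_add set_integral_diff ci mean)
  finally have "m\<^sup>2 * (b - a) \<le> (LINT s:{a<..b}|lborel. (g s)\<^sup>2)" by (simp add: power2_eq_square)
  then have "(b - a) * (m\<^sup>2 * (b - a)) \<le> (b - a) * (LINT s:{a<..b}|lborel. (g s)\<^sup>2)"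
    using \<open>a < b\<close> by (intro mult_left_mono) auto
  then show ?thesis by (simp add: mean power2_eq_square mult_ac)
qed

text \<open>An integral rather than a piecewise linear expression, so that the derivative can be read off and
  equals the integrand of \<open>ito_integral_indicator\<close>.\<close>

definition ramp :: "real \<Rightarrow> real \<Rightarrow> real \<Rightarrow> real" where
  "ramp a b t = (LINT s:{0..t}|lborel. indicator {a<..b} s)"

lemma h1_derivative_ramp: "h1_derivative T (ramp a b) (indicator {a<..b})"
proof -
  have "emeasure lborel {a<..b} < \<infinity>" by (cases "a \<le> b") auto
  moreover have "(\<lambda>s. (indicator {a<..b} s :: real)\<^sup>2) = indicator {a<..b}" by (auto simp: indicator_def)
  ultimately show ?thesis
    by (auto simp: h1_derivative_def ramp_def set_borel_measurable_def set_integrable_def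
        intro!: integrable_mult_indicator[where 'b=real, simplified] integrable_real_indicator)
qed

lemma ramp_increment:
  assumes "0 \<le> a" "a \<le> b"
  shows "ramp a b b - ramp a b a = b - a"
proof -
  have "ramp a b b - ramp a b a = (LINT s:{a<..b}|lborel. indicator {a<..b} s * 1)"
    using h1_derivative_increment[OF h1_derivative_ramp, of a b b a b] assms by simp
  also have "\<dots> = b - a"
    unfolding set_integral_indicator_Int using assms by (simp add: set_lebesgue_integral_def)
  finally show ?thesis .
qed

section \<open>A variance bound from a Gaussian change of measure\<close>

text \<open>Completing the square: the exponential tilt of a centred normal density is a multiple of the
  normal density with mean \<open>c * \<sigma>\<^sup>2\<close>.\<close>

lemma normal_density_exp_moment:
  assumes "0 < \<sigma>"
  shows "has_bochner_integral lborel (\<lambda>x. normal_density 0 \<sigma> x * exp (c * x)) (exp (c\<^sup>2 * \<sigma>\<^sup>2 / 2))"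
proof -
  have "normal_density 0 \<sigma> x * exp (c * x) = exp (c\<^sup>2 * \<sigma>\<^sup>2 / 2) * normal_density (c * \<sigma>\<^sup>2) \<sigma> x" for x
  proof -
    have "- (x\<^sup>2) / (2 * \<sigma>\<^sup>2) + c * x = c\<^sup>2 * \<sigma>\<^sup>2 / 2 - (x - c * \<sigma>\<^sup>2)\<^sup>2 / (2 * \<sigma>\<^sup>2)"
      using assms by (simp add: field_simps power2_eq_square)
    then have "exp (- (x\<^sup>2) / (2 * \<sigma>\<^sup>2)) * exp (c * x) = exp (c\<^sup>2 * \<sigma>\<^sup>2 / 2) * exp (- (x - c * \<sigma>\<^sup>2)\<^sup>2 / (2 * \<sigma>\<^sup>2))"
      by (simp flip: exp_add)
    then show ?thesis by (simp add: normal_density_def)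
  qed
  moreover have "has_bochner_integral lborel (\<lambda>x. exp (c\<^sup>2 * \<sigma>\<^sup>2 / 2) * normal_density (c * \<sigma>\<^sup>2) \<sigma> x) (exp (c\<^sup>2 * \<sigma>\<^sup>2 / 2) * 1)"
    using assms by (intro has_bochner_integral_mult_right) (simp_all add: has_bochner_integral_iff)
  ultimately show ?thesis by simp
qed

lemma (in prob_space) normal_exp_expectation:
  assumes "0 < \<sigma>" and D: "distributed M lborel D (normal_density 0 \<sigma>)"
  shows "integrable M (\<lambda>\<omega>. exp (c * D \<omega>))" and "expectation (\<lambda>\<omega>. exp (c * D \<omega>)) = exp (c\<^sup>2 * \<sigma>\<^sup>2 / 2)"
  using normal_density_exp_moment[OF assms(1), of c]
    distributed_integrable[OF D, of "\<lambda>x. exp (c * x)"] distributed_integral[OF D, of "\<lambda>x. exp (c * x)"]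
  by (auto simp: has_bochner_integral_iff)

text \<open>The Cramer-Rao bound in finite difference form. If \<open>Y\<close> has mean zero, and mean \<open>\<tau>\<close> after the
  change of measure with density \<open>Z = exp (D - \<tau> / 2)\<close>, then \<open>\<tau>\<close> is the expectation of
  \<open>(Z - 1) * Y\<close>, which is at most that of \<open>Y\<^sup>2 + (Z - 1)\<^sup>2 / 4\<close>. The second moment of \<open>Z - 1\<close> is
  \<open>exp \<tau> - 1 \<le> 2 * \<tau>\<close>, which leaves \<open>\<tau> / 2\<close> for \<open>Y\<^sup>2\<close>. A finite difference thus takes
  the place of the derivative of an expectation with respect to the drift.\<close>

lemma (in prob_space) translation_variance_bound:
  assumes \<tau>: "0 < \<tau>" "\<tau> \<le> 1"
    and D: "distributed M lborel D (normal_density 0 (sqrt \<tau>))"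
    and Y: "integrable M Y" "expectation Y = 0"
    and YZ: "integrable M (\<lambda>\<omega>. exp (D \<omega> - \<tau> / 2) * Y \<omega>)" "expectation (\<lambda>\<omega>. exp (D \<omega> - \<tau> / 2) * Y \<omega>) = \<tau>"
  shows "ennreal (\<tau> / 2) \<le> (\<integral>\<^sup>+ \<omega>. ennreal ((Y \<omega>)\<^sup>2) \<partial>M)"
proof (cases "integrable M (\<lambda>\<omega>. (Y \<omega>)\<^sup>2)")
  case True
  let ?Z = "\<lambda>\<omega>. exp (D \<omega> - \<tau> / 2)"
  have s: "0 < sqrt \<tau>" using \<tau> by simp
  have Z1: "?Z = (\<lambda>\<omega>. exp (- \<tau> / 2) * exp (1 * D \<omega>))"
    by (auto simp flip: exp_add)
  have Z2: "(\<lambda>\<omega>. (?Z \<omega>)\<^sup>2) = (\<lambda>\<omega>. exp (- \<tau>) * exp (2 * D \<omega>))"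
    by (auto simp: power2_eq_square simp flip: exp_add)
  have iZ: "integrable M ?Z" "integrable M (\<lambda>\<omega>. (?Z \<omega>)\<^sup>2)"
    unfolding Z1 Z2 by (intro integrable_mult_right normal_exp_expectation[OF s D])+
  have Z_mean: "expectation ?Z = 1"
    unfolding Z1 integral_mult_right_zero normal_exp_expectation(2)[OF s D] using \<tau> by (simp flip: exp_add)
  have Z_square: "expectation (\<lambda>\<omega>. (?Z \<omega>)\<^sup>2) = exp \<tau>"
    unfolding Z2 integral_mult_right_zero normal_exp_expectation(2)[OF s D] using \<tau> by (simp flip: exp_add)
  have "\<tau> = expectation (\<lambda>\<omega>. ?Z \<omega> * Y \<omega> - Y \<omega>)"
    using Y YZ by simp
  also have "\<dots> \<le> expectation (\<lambda>\<omega>. (Y \<omega>)\<^sup>2 + ((?Z \<omega>)\<^sup>2 - 2 * ?Z \<omega> + 1) / 4)"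
  proof (intro integral_mono)
    show "integrable M (\<lambda>\<omega>. ?Z \<omega> * Y \<omega> - Y \<omega>)" using Y YZ by simp
    show "integrable M (\<lambda>\<omega>. (Y \<omega>)\<^sup>2 + ((?Z \<omega>)\<^sup>2 - 2 * ?Z \<omega> + 1) / 4)" using True iZ by simp
    \<comment> \<open>Nonnegativity of the square of \<open>y - (z - 1) / 2\<close>.\<close>
    show "z * y - y \<le> y\<^sup>2 + (z\<^sup>2 - 2 * z + 1) / 4" for z y :: real
      using zero_le_power2[of "y - (z - 1) / 2"] by (simp add: power2_eq_square field_simps)
  qed
  also have "\<dots> = expectation (\<lambda>\<omega>. (Y \<omega>)\<^sup>2) + (expectation (\<lambda>\<omega>. (?Z \<omega>)\<^sup>2) - 2 * expectation ?Z + 1) / 4"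
    using True iZ by (simp add: prob_space)
  also have "\<dots> = expectation (\<lambda>\<omega>. (Y \<omega>)\<^sup>2) + (exp \<tau> - 1) / 4"
    unfolding Z_mean Z_square by simp
  also have "exp \<tau> - 1 \<le> 2 * \<tau>"
  proof -
    have "\<tau>\<^sup>2 \<le> \<tau>" using \<tau> by (simp add: power2_eq_square mult_left_le)
    then show ?thesis using exp_bound[of \<tau>] \<tau> by simp
  qed
  finally have "\<tau> / 2 \<le> expectation (\<lambda>\<omega>. (Y \<omega>)\<^sup>2)" by simp
  then show ?thesis
    by (subst nn_integral_eq_integral[OF True]) (auto intro: ennreal_leI)
next
  case False
  then have "(\<integral>\<^sup>+ \<omega>. ennreal ((Y \<omega>)\<^sup>2) \<partial>M) = \<infinity>"
    using Y(1) by (subst (asm) integrable_iff_bounded) (auto simp: less_top[symmetric])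
  then show ?thesis by simp
qed

section \<open>The ratio of two Girsanov densities\<close>

lemma drift_derivative_path:
  assumes "drift_derivative M F T u v" "0 \<le> T"
  shows "AE \<omega> in M. h1_derivative T (\<lambda>t. u t \<omega>) (\<lambda>s. v s \<omega>)"
proof -
  have m: "measurable_process M T v" and
    ae: "AE \<omega> in M. set_integrable lborel {0..T} (\<lambda>s. (v s \<omega>)\<^sup>2)"
      "AE \<omega> in M. \<forall>t\<in>{0..T}. u t \<omega> = (LINT s:{0..t}|lborel. v s \<omega>)"
    using assms by (auto simp: drift_derivative_def)
  show ?thesis
    using ae AE_space
  proof eventually_elim
    case (elim \<omega>)
    then show ?case
      using measurable_process_path[OF m assms(2), of \<omega>] by (simp add: h1_derivative_def set_borel_measurable_def)
  qed
qed

context brownian_space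
begin

text \<open>Both \<open>v'\<close> and \<open>v\<close> plus the slope of the ramp are derivatives of the shifted drift, so they agree
  almost everywhere, and uniqueness of the Ito integral gives that \<open>J' - J\<close> is the increment of
  \<open>X\<close>. The squares differ by \<open>2 v + 1\<close> on the ramp, whose integral is
  \<open>2 (u b - u a) + (b - a)\<close>; this turns the increment of \<open>X\<close> into that of \<open>X - u\<close>, which is Gaussian
  under the measure of \<open>u\<close>.\<close>

lemma log_density_ratio:
  assumes ab: "0 \<le> a" "a \<le> b" "b \<le> T"
    and v: "drift_derivative M F T u v" and J: "ito_integral M F T X v J"
    and v': "drift_derivative M F T (\<lambda>t \<omega>. u t \<omega> + indicator {0..T} t * ramp a b t) v'"
    and J': "ito_integral M F T X v' J'"
  shows "AE \<omega> in M. J' \<omega> - 1 / 2 * (LINT s:{0..T}|lborel. (v' s \<omega>)\<^sup>2) =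
    (J \<omega> - 1 / 2 * (LINT s:{0..T}|lborel. (v s \<omega>)\<^sup>2)) + (((X b \<omega> - u b \<omega>) - (X a \<omega> - u a \<omega>)) - (b - a) / 2)"
proof -
  have T: "0 \<le> T" using ab by simp
  let ?g = "\<lambda>s. indicator {a<..b} s :: real"
  have m: "measurable_process M T v" "measurable_process M T v'" "measurable_process M T (\<lambda>s \<omega>. ?g s)"
    using v v' by (auto simp: drift_derivative_def intro!: measurable_process_deterministic)
  have path: "AE \<omega> in M. h1_derivative T (\<lambda>t. u t \<omega>) (\<lambda>s. v s \<omega>) \<and>
      (AE s in lborel. s \<in> {0..T} \<longrightarrow> v' s \<omega> = v s \<omega> + ?g s)"
    using drift_derivative_path[OF v T] drift_derivative_path[OF v' T]
  proof eventually_elim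
    case (elim \<omega>)
    show ?case
      using h1_derivative_unique[OF elim(2) h1_derivative_add[OF elim(1) h1_derivative_ramp[of T a b]]] elim(1)
      by simp
  qed
  have "AE \<omega> in M. (J' \<omega> - J \<omega>) - (X b \<omega> - X a \<omega>) = 0"
  proof (rule ito_integral_unique_0[OF T])
    show "measurable_process M T (\<lambda>s \<omega>. (v' s \<omega> - v s \<omega>) - ?g s)"
      using m by (intro measurable_process_diff)
    show "ito_integral M F T X (\<lambda>s \<omega>. (v' s \<omega> - v s \<omega>) - ?g s) (\<lambda>\<omega>. (J' \<omega> - J \<omega>) - (X b \<omega> - X a \<omega>))"
      using m by (intro ito_integral_diff[OF T] measurable_process_diff J J' ito_integral_indicator ab)
    show "AE \<omega> in M. AE s in lborel. s \<in> {0..T} \<longrightarrow> (v' s \<omega> - v s \<omega>) - ?g s = 0"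
      using path by eventually_elim (auto elim: eventually_mono)
  qed
  with path AE_space show ?thesis
  proof eventually_elim
    case (elim \<omega>)
    then have d: "h1_derivative T (\<lambda>t. u t \<omega>) (\<lambda>s. v s \<omega>)"
      and ae: "AE s in lborel. s \<in> {0..T} \<longrightarrow> v' s \<omega> = v s \<omega> + ?g s" by auto
    have v2: "set_integrable lborel {0..T} (\<lambda>s. (v s \<omega>)\<^sup>2)"
      using d by (simp add: h1_derivative_def)
    have vg: "set_integrable lborel {0..T} (\<lambda>s. ?g s * v s \<omega>)"
    proof -
      have "set_integrable lborel ({0..T} \<inter> {a<..b}) (\<lambda>s. v s \<omega>)"
        by (rule set_integrable_subset[OF h1_derivative_integrable[OF d]]) auto
      then show ?thesis by (simp add: set_integrable_def indicator_inter_arith mult.assoc)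
    qed
    have g: "set_integrable lborel {0..T} ?g"
      using h1_derivative_integrable[OF h1_derivative_ramp[of T a b]] by simp
    have ab': "{0..T} \<inter> {a<..b} = {a<..b}" using ab by auto
    have sum: "set_integrable lborel {0..T} (\<lambda>s. (v s \<omega>)\<^sup>2 + (2 * (?g s * v s \<omega>) + ?g s))"
      using v2 vg g by (intro set_integral_add) auto
    have "(LINT s:{0..T}|lborel. (v' s \<omega>)\<^sup>2) = (LINT s|lborel. (indicator {0..T} s * v' s \<omega>)\<^sup>2)"
      unfolding set_lebesgue_integral_def
      by (intro Bochner_Integration.integral_cong) (auto simp: indicator_def)
    also have "\<dots> = (LINT s:{0..T}|lborel. (v s \<omega>)\<^sup>2 + (2 * (?g s * v s \<omega>) + ?g s))"
      unfolding set_lebesgue_integral_def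
    proof (rule integral_cong_AE)
      show "AE s in lborel. (indicator {0..T} s * v' s \<omega>)\<^sup>2 =
          indicator {0..T} s *\<^sub>R ((v s \<omega>)\<^sup>2 + (2 * (?g s * v s \<omega>) + ?g s))"
        using ae by eventually_elim (auto simp: indicator_def power2_eq_square algebra_simps)
    qed (use sum measurable_process_path[OF m(2) T \<open>\<omega> \<in> space M\<close>] in
        \<open>auto simp: set_integrable_def intro: borel_measurable_power\<close>)
    also have "\<dots> = (LINT s:{0..T}|lborel. (v s \<omega>)\<^sup>2) + (2 * (LINT s:{0..T}|lborel. ?g s * v s \<omega>) + (LINT s:{0..T}|lborel. ?g s * 1))"
      using v2 vg g by (simp add: set_integral_add)
    also have "(LINT s:{0..T}|lborel. ?g s * v s \<omega>) = u b \<omega> - u a \<omega>"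
      unfolding set_integral_indicator_Int ab' using h1_derivative_increment[OF d ab] by simp
    also have "(LINT s:{0..T}|lborel. ?g s * 1) = b - a"
      unfolding set_integral_indicator_Int ab' using ab by (simp add: set_lebesgue_integral_def)
    finally have "(LINT s:{0..T}|lborel. (v' s \<omega>)\<^sup>2) =
        (LINT s:{0..T}|lborel. (v s \<omega>)\<^sup>2) + (2 * (u b \<omega> - u a \<omega>) + (b - a))" .
    with elim(3) show ?case by (simp add: field_simps)
  qed
qed

lemma measurable_girsanov_density:
  assumes "girsanov_density M F T X u L" "0 \<le> T"
  shows "L \<in> borel_measurable M"
proof -
  obtain v J where v: "measurable_process M T v" and [measurable]: "J \<in> borel_measurable M"
    and L: "L = (\<lambda>\<omega>. exp (J \<omega> - 1 / 2 * (LINT s:{0..T}|lborel. (v s \<omega>)\<^sup>2)))"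
    using assms(1) unfolding girsanov_density_def drift_derivative_def ito_integral_def by blast
  note [measurable] = measurable_process_extend[OF v assms(2)]
  have "(\<lambda>x. ((\<lambda>(\<omega>, s). indicator {0..T} s * v s \<omega>) x)\<^sup>2) \<in> borel_measurable (M \<Otimes>\<^sub>M lborel)"
    by measurable
  also have "(\<lambda>x. ((\<lambda>(\<omega>, s). indicator {0..T} s * v s \<omega>) x)\<^sup>2) =
      (\<lambda>(\<omega>, s). indicator {0..T} s *\<^sub>R (v s \<omega>)\<^sup>2)"
    by (auto simp: indicator_def fun_eq_iff)
  finally have [measurable]: "(\<lambda>\<omega>. LINT s:{0..T}|lborel. (v s \<omega>)\<^sup>2) \<in> borel_measurable M"
    unfolding set_lebesgue_integral_def by (rule lborel.borel_measurable_lebesgue_integral)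
  show ?thesis unfolding L by measurable
qed

lemma girsanov_density_ramp_shift:
  assumes ab: "0 \<le> a" "a \<le> b" "b \<le> T"
    and L: "girsanov_density M F T X u L"
    and L': "girsanov_density M F T X (\<lambda>t \<omega>. u t \<omega> + indicator {0..T} t * ramp a b t) L'"
  shows "AE \<omega> in M. L' \<omega> = L \<omega> * exp (((X b \<omega> - u b \<omega>) - (X a \<omega> - u a \<omega>)) - (b - a) / 2)"
proof -
  obtain v J where v: "drift_derivative M F T u v" and J: "ito_integral M F T X v J"
    and L: "L = (\<lambda>\<omega>. exp (J \<omega> - 1 / 2 * (LINT s:{0..T}|lborel. (v s \<omega>)\<^sup>2)))"
    using L unfolding girsanov_density_def by blast
  obtain v' J' where v': "drift_derivative M F T (\<lambda>t \<omega>. u t \<omega> + indicator {0..T} t * ramp a b t) v'"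
    and J': "ito_integral M F T X v' J'"
    and L': "L' = (\<lambda>\<omega>. exp (J' \<omega> - 1 / 2 * (LINT s:{0..T}|lborel. (v' s \<omega>)\<^sup>2)))"
    using L' unfolding girsanov_density_def by blast
  show ?thesis
    using log_density_ratio[OF ab v J v' J'] unfolding L L'
    by eventually_elim (simp only: exp_add[symmetric])
qed

text \<open>The two measures are defined through arbitrarily chosen densities; \<open>girsanov_density_ramp_shift\<close>
  holds for all choices and therefore for these.\<close>

lemma drift_measure_ramp_shift:
  assumes ab: "0 \<le> a" "a \<le> b" "b \<le> T"
    and u: "girsanov_drift M F T X u"
    and w: "girsanov_drift M F T X (\<lambda>t \<omega>. u t \<omega> + indicator {0..T} t * ramp a b t)"
  shows "drift_measure M F T X (\<lambda>t \<omega>. u t \<omega> + indicator {0..T} t * ramp a b t) =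
    density (drift_measure M F T X u)
      (\<lambda>\<omega>. ennreal (exp (((X b \<omega> - u b \<omega>) - (X a \<omega> - u a \<omega>)) - (b - a) / 2)))"
proof -
  let ?w = "\<lambda>t \<omega>. u t \<omega> + indicator {0..T} t * ramp a b t"
    and ?Z = "\<lambda>\<omega>. exp (((X b \<omega> - u b \<omega>) - (X a \<omega> - u a \<omega>)) - (b - a) / 2)"
  define L where "L = (SOME L. girsanov_density M F T X u L)"
  define L' where "L' = (SOME L. girsanov_density M F T X ?w L)"
  have T: "0 \<le> T" using ab by simp
  have L: "girsanov_density M F T X u L"
    unfolding L_def using u by (intro someI_ex[of "girsanov_density M F T X u"]) (auto simp: girsanov_drift_def)
  have L': "girsanov_density M F T X ?w L'"
    unfolding L'_def using w by (intro someI_ex[of "girsanov_density M F T X ?w"]) (auto simp: girsanov_drift_def)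
  note [measurable] = measurable_girsanov_density[OF L T] measurable_girsanov_density[OF L' T]
  have um: "u t \<in> borel_measurable M" if "0 \<le> t" "t \<le> T" for t
    using u that by (intro measurable_filtration[of _ t]) (auto simp: girsanov_drift_def adapted_def)
  have [measurable]: "u a \<in> borel_measurable M" "u b \<in> borel_measurable M"
    "X a \<in> borel_measurable M" "X b \<in> borel_measurable M"
    using ab by (auto intro!: um process_measurable)
  have L0: "0 \<le> L \<omega>" for \<omega>
    using L by (auto simp: girsanov_density_def)
  have "density M (\<lambda>\<omega>. ennreal (L' \<omega>)) = density M (\<lambda>\<omega>. ennreal (L \<omega>) * ennreal (?Z \<omega>))"
  proof (rule density_cong)
    show "AE \<omega> in M. ennreal (L' \<omega>) = ennreal (L \<omega>) * ennreal (?Z \<omega>)"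
      using girsanov_density_ramp_shift[OF ab L L']
      by eventually_elim (simp add: ennreal_mult' L0)
  qed measurable
  also have "\<dots> = density (density M (\<lambda>\<omega>. ennreal (L \<omega>))) (\<lambda>\<omega>. ennreal (?Z \<omega>))"
    by (rule density_density_eq[symmetric]) measurable
  finally show ?thesis
    unfolding drift_measure_def L_def[symmetric] L'_def[symmetric] .
qed

section \<open>Unbiasedness is incompatible with finite risk\<close>

text \<open>An unbiased estimator follows the ramp on average: the increment of \<open>\<xi> - u\<close> has mean zero under
  the measure of \<open>u\<close>, and mean \<open>b - a\<close> under that of \<open>u\<close> plus the ramp. Hence the variance bound
  applies.\<close>

lemma unbiased_increment_bound:
  assumes par: "drift_parameter_space M F T X \<Theta>" and unb: "unbiased_estimator M F T X \<Theta> \<xi>"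
    and u: "u \<in> \<Theta>" and ab: "0 \<le> a" "a < b" "b \<le> T" "b - a \<le> 1"
  shows "ennreal ((b - a) / 2) \<le>
    (\<integral>\<^sup>+ \<omega>. ennreal (((\<xi> b \<omega> - u b \<omega>) - (\<xi> a \<omega> - u a \<omega>))\<^sup>2) \<partial>drift_measure M F T X u)"
proof -
  let ?w = "\<lambda>t \<omega>. u t \<omega> + indicator {0..T} t * ramp a b t"
    and ?N = "drift_measure M F T X u"
    and ?D = "\<lambda>\<omega>. (X b \<omega> - u b \<omega>) - (X a \<omega> - u a \<omega>)"
    and ?Y = "\<lambda>\<omega>. (\<xi> b \<omega> - u b \<omega>) - (\<xi> a \<omega> - u a \<omega>)"
  let ?N' = "drift_measure M F T X ?w"
  let ?Z = "\<lambda>\<omega>. exp (?D \<omega> - (b - a) / 2)"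
  have "ramp a b \<in> H10 T" using h1_derivative_ramp by (auto simp: H10_def)
  then have w: "?w \<in> \<Theta>" using par u by (auto simp: drift_parameter_space_def)
  have gir: "girsanov_drift M F T X u" "girsanov_drift M F T X ?w"
    using par u w by (auto simp: drift_parameter_space_def)
  interpret N: prob_space ?N using gir(1) by (simp add: girsanov_drift_def)
  interpret N': prob_space ?N' using gir(2) by (simp add: girsanov_drift_def)
  have int: "integrable (drift_measure M F T X x) (\<xi> t)" "integrable (drift_measure M F T X x) (x t)"
    "(\<integral>\<omega>. \<xi> t \<omega> \<partial>drift_measure M F T X x) = (\<integral>\<omega>. x t \<omega> \<partial>drift_measure M F T X x)"
    if "x \<in> \<Theta>" "t \<in> {0..T}" for x t
    using par unb that by (auto simp: drift_parameter_space_def unbiased_estimator_def)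
  have t: "a \<in> {0..T}" "b \<in> {0..T}" using ab by auto
  note iu = int[OF u t(1)] int[OF u t(2)] and iw = int[OF w t(1)] int[OF w t(2)]
  have D: "distributed ?N lborel ?D (normal_density 0 (sqrt (b - a)))"
    using gir(1) ab by (auto simp: girsanov_drift_def brownian_motion_def)
  have Y: "integrable ?N ?Y" "N.expectation ?Y = 0"
    using iu by simp_all
  \<comment> \<open>Rewritten in terms of the drift for which the estimator is unbiased under the second measure.\<close>
  have Yw: "?Y = (\<lambda>\<omega>. (\<xi> b \<omega> - ?w b \<omega>) - (\<xi> a \<omega> - ?w a \<omega>) + (b - a))"
    using ramp_increment[of a b] ab t by (auto simp: algebra_simps)
  have Y': "integrable ?N' ?Y" "N'.expectation ?Y = b - a"
  proof -
    have i: "integrable ?N' (\<lambda>\<omega>. (\<xi> b \<omega> - ?w b \<omega>) - (\<xi> a \<omega> - ?w a \<omega>))"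
      by (intro Bochner_Integration.integrable_diff iw)
    then show "integrable ?N' ?Y" unfolding Yw by (intro Bochner_Integration.integrable_add) simp_all
    have "N'.expectation (\<lambda>\<omega>. (\<xi> b \<omega> - ?w b \<omega>) - (\<xi> a \<omega> - ?w a \<omega>)) = 0"
      by (subst Bochner_Integration.integral_diff, (intro Bochner_Integration.integrable_diff iw)+)
        (simp add: Bochner_Integration.integral_diff[OF iw(1,2)] Bochner_Integration.integral_diff[OF iw(4,5)] iw(3,6))
    then show "N'.expectation ?Y = b - a"
      unfolding Yw using i by (subst Bochner_Integration.integral_add) (simp_all add: N'.prob_space)
  qed
  have shift: "?N' = density ?N (\<lambda>\<omega>. ennreal (?Z \<omega>))"
    using drift_measure_ramp_shift[OF ab(1) less_imp_le[OF ab(2)] ab(3) gir] .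
  have "?D \<in> borel_measurable ?N"
    using distributed_measurable[OF D] by simp
  then have Z: "?Z \<in> borel_measurable ?N" by measurable
  have Ym: "?Y \<in> borel_measurable ?N" using Y(1) by (rule borel_measurable_integrable)
  show ?thesis
  proof (rule N.translation_variance_bound[OF _ ab(4) D Y])
    show "integrable ?N (\<lambda>\<omega>. ?Z \<omega> * ?Y \<omega>)"
      using Y'(1) unfolding shift by (subst (asm) integrable_real_density[OF Z _ Ym]) simp_all
    show "N.expectation (\<lambda>\<omega>. ?Z \<omega> * ?Y \<omega>) = b - a"
      using Y'(2) unfolding shift by (subst (asm) integral_real_density[OF Z _ Ym]) simp_all
  qed (use ab in simp)
qed

end

text \<open>Cauchy-Schwarz on each cell of an equidistant partition. When \<open>h\<close> has no square integrable
  derivative, the right-hand side is infinite.\<close>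

lemma h1_norm_ge_increments:
  assumes "0 < T" and "0 < n"
  shows "(\<Sum>i<n. ennreal (real n / T) * ennreal ((h (T * real (Suc i) / real n) - h (T * real i / real n))\<^sup>2)) \<le> (h1_norm T h)\<^sup>2"
proof (cases "h \<in> H10 T")
  case False
  then have "(h1_norm T h)\<^sup>2 = top" by (simp add: h1_norm_def power2_eq_square)
  then show ?thesis by (simp only: top_greatest)
next
  case True
  define g where "g = (SOME g. h1_derivative T h g)"
  have g: "h1_derivative T h g"
    unfolding g_def using True unfolding H10_def mem_Collect_eq by (rule someI_ex)
  let ?p = "\<lambda>i. T * real i / real n"
  have p_diff: "?p (Suc i) - ?p i = T / real n" for i
    by (simp add: distrib_left add_divide_distrib)
  have "0 < T / real n" using assms by simp
  then have p: "0 \<le> ?p i" "?p i < ?p (Suc i)" for i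
    using p_diff[of i] assms by (simp, linarith)
  have p_mono: "?p i \<le> ?p j" if "i \<le> j" for i j
    using assms that by (auto intro!: divide_right_mono mult_left_mono)
  have pT: "?p i \<le> T" if "i \<le> n" for i
    using p_mono[OF that] assms by simp
  have g2: "set_integrable lborel {0..T} (\<lambda>s. (g s)\<^sup>2)" using g by (simp add: h1_derivative_def)
  have cell: "{?p i<..?p (Suc i)} \<subseteq> {0..T}" if "i < n" for i
    using p(1)[of i] pT[of "Suc i"] that by auto
  have cell_int: "set_integrable lborel {?p i<..?p (Suc i)} (\<lambda>s. (g s)\<^sup>2)" if "i < n" for i
    by (rule set_integrable_subset[OF g2 _ cell[OF that]]) simp
  have "(\<Sum>i<n. real n / T * (h (?p (Suc i)) - h (?p i))\<^sup>2) \<le> (\<Sum>i<n. LINT s:{?p i<..?p (Suc i)}|lborel. (g s)\<^sup>2)"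
  proof (rule sum_mono)
    fix i assume "i \<in> {..<n}"
    then have i: "i < n" by simp
    have "(LINT s:{?p i<..?p (Suc i)}|lborel. g s)\<^sup>2 \<le> (?p (Suc i) - ?p i) * (LINT s:{?p i<..?p (Suc i)}|lborel. (g s)\<^sup>2)"
      by (intro square_set_integral_le p cell_int i set_integrable_subset[OF h1_derivative_integrable[OF g] _ cell[OF i]]) simp
    also have "(LINT s:{?p i<..?p (Suc i)}|lborel. g s) = h (?p (Suc i)) - h (?p i)"
      using h1_derivative_increment[OF g p(1) less_imp_le[OF p(2)] pT[of "Suc i"]] i by simp
    also have "?p (Suc i) - ?p i = T / real n" by (rule p_diff)
    finally have "(h (?p (Suc i)) - h (?p i))\<^sup>2 \<le> T / real n * (LINT s:{?p i<..?p (Suc i)}|lborel. (g s)\<^sup>2)" .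
    then have "real n / T * (h (?p (Suc i)) - h (?p i))\<^sup>2 \<le>
        real n / T * (T / real n * (LINT s:{?p i<..?p (Suc i)}|lborel. (g s)\<^sup>2))"
      using assms by (intro mult_left_mono) auto
    then show "real n / T * (h (?p (Suc i)) - h (?p i))\<^sup>2 \<le> (LINT s:{?p i<..?p (Suc i)}|lborel. (g s)\<^sup>2)"
      using assms by simp
  qed
  also have "\<dots> = (LINT s:(\<Union>i<n. {?p i<..?p (Suc i)})|lborel. (g s)\<^sup>2)"
  proof (rule set_integral_finite_Union[symmetric])
    show "disjoint_family_on (\<lambda>i. {?p i<..?p (Suc i)}) {..<n}"
      unfolding disjoint_family_on_def
    proof (intro ballI impI)
      fix i j :: nat assume "i \<noteq> j"
      then consider "Suc i \<le> j" | "Suc j \<le> i" by linarith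
      then show "{?p i<..?p (Suc i)} \<inter> {?p j<..?p (Suc j)} = {}"
      proof cases
        case 1
        from p_mono[OF this] show ?thesis by (auto simp del: of_nat_Suc)
      next
        case 2
        from p_mono[OF this] show ?thesis by (auto simp del: of_nat_Suc)
      qed
    qed
    show "set_integrable lborel {?p i<..?p (Suc i)} (\<lambda>s. (g s)\<^sup>2)" if "i \<in> {..<n}" for i
      using cell_int that unfolding lessThan_iff .
  qed simp_all
  also have "\<dots> \<le> (LINT s:{0..T}|lborel. (g s)\<^sup>2)"
  proof -
    have sub: "(\<Union>i<n. {?p i<..?p (Suc i)}) \<subseteq> {0..T}"
      by (intro UN_least cell) (simp only: lessThan_iff)
    have int: "set_integrable lborel (\<Union>i<n. {?p i<..?p (Suc i)}) (\<lambda>s. (g s)\<^sup>2)"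
      by (rule set_integrable_subset[OF g2 _ sub]) (intro sets.countable_UN' countable_finite, auto)
    show ?thesis
      unfolding set_lebesgue_integral_def
    proof (rule integral_mono[OF int[unfolded set_integrable_def] g2[unfolded set_integrable_def]])
      fix s
      have "indicator (\<Union>i<n. {?p i<..?p (Suc i)}) s \<le> (indicator {0..T} s :: real)"
        by (rule indicator_leI) (rule subsetD[OF sub])
      then show "indicator (\<Union>i<n. {?p i<..?p (Suc i)}) s *\<^sub>R (g s)\<^sup>2 \<le> indicator {0..T} s *\<^sub>R (g s)\<^sup>2"
        by (simp only: real_scaleR_def mult_right_mono zero_le_power2)
    qed
  qed
  finally have le: "(\<Sum>i<n. real n / T * (h (?p (Suc i)) - h (?p i))\<^sup>2) \<le> (LINT s:{0..T}|lborel. (g s)\<^sup>2)" .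
  have "0 \<le> (LINT s:{0..T}|lborel. (g s)\<^sup>2)"
    unfolding set_lebesgue_integral_def by (intro Bochner_Integration.integral_nonneg) auto
  then have "(h1_norm T h)\<^sup>2 = ennreal (LINT s:{0..T}|lborel. (g s)\<^sup>2)"
    using True by (simp add: h1_norm_def g_def[symmetric] ennreal_power)
  moreover have "(\<Sum>i<n. ennreal (real n / T) * ennreal ((h (?p (Suc i)) - h (?p i))\<^sup>2)) =
      ennreal (\<Sum>i<n. real n / T * (h (?p (Suc i)) - h (?p i))\<^sup>2)"
  proof -
    have "ennreal (real n / T) * ennreal (x\<^sup>2) = ennreal (real n / T * x\<^sup>2)" for x
      by (rule ennreal_mult[symmetric]) (use assms in auto)
    then show ?thesis using assms by (simp only:) (intro sum_ennreal mult_nonneg_nonneg, auto)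
  qed
  ultimately show ?thesis using le by (simp add: ennreal_leI)
qed

theorem theorem2p5:
  fixes M :: "'a measure" and F :: "real \<Rightarrow> 'a measure" and T :: real
    and X \<xi> :: "real \<Rightarrow> 'a \<Rightarrow> real" and \<Theta> :: "(real \<Rightarrow> 'a \<Rightarrow> real) set"
  assumes "T > 0"
    and "filtered_prob_space M F T"
    and "brownian_motion M F T X"
    and "drift_parameter_space M F T X \<Theta>"
    and "measurable_process M T \<xi>"
    and "\<exists>u\<in>\<Theta>. (\<integral>\<^sup>+ \<omega>. (h1_norm T (\<lambda>t. \<xi> t \<omega> - u t \<omega>))\<^sup>2 \<partial>drift_measure M F T X u) < \<infinity>"
  shows "\<not> unbiased_estimator M F T X \<Theta> \<xi>"
proof
  assume unb: "unbiased_estimator M F T X \<Theta> \<xi>"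
  interpret brownian_space M F T X
    using assms(2,3) by (auto simp: brownian_space_def brownian_space_axioms_def filtered_prob_space_def)
  obtain u where u: "u \<in> \<Theta>"
    and fin: "(\<integral>\<^sup>+ \<omega>. (h1_norm T (\<lambda>t. \<xi> t \<omega> - u t \<omega>))\<^sup>2 \<partial>drift_measure M F T X u) < \<infinity>"
    using assms(6) by blast
  let ?N = "drift_measure M F T X u"
  let ?e = "\<integral>\<^sup>+ \<omega>. (h1_norm T (\<lambda>t. \<xi> t \<omega> - u t \<omega>))\<^sup>2 \<partial>?N"
  have meas: "\<xi> t \<in> borel_measurable ?N" "u t \<in> borel_measurable ?N" if "t \<in> {0..T}" for t
    using assms(4) unb u that unfolding drift_parameter_space_def unbiased_estimator_def
    by (blast intro: borel_measurable_integrable)+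
  have bound: "ennreal (real n / 2) \<le> ?e" if n: "T \<le> real n" for n :: nat
  proof -
    let ?p = "\<lambda>i. T * real i / real n"
    let ?Y = "\<lambda>i \<omega>. (\<xi> (?p (Suc i)) \<omega> - u (?p (Suc i)) \<omega>) - (\<xi> (?p i) \<omega> - u (?p i) \<omega>)"
    have n0: "0 < n" using n \<open>T > 0\<close> by (cases n) auto
    have p_diff: "?p (Suc i) - ?p i = T / real n" for i
      by (simp add: distrib_left add_divide_distrib)
    have "0 < T / real n" using \<open>T > 0\<close> n0 by simp
    then have p: "0 \<le> ?p i" "?p i < ?p (Suc i)" for i
      using p_diff[of i] \<open>T > 0\<close> by (simp, linarith)
    have pT: "?p i \<le> T" if "i \<le> n" for i
    proof -
      have "?p i \<le> T * real n / real n"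
        using that \<open>T > 0\<close> by (intro divide_right_mono mult_left_mono) auto
      then show ?thesis using n0 by simp
    qed
    have "ennreal (real n / 2) = (\<Sum>i<n. ennreal (real n / T) * ennreal (T / real n / 2))"
    proof -
      have "ennreal (real n / T) * ennreal (T / real n / 2) = ennreal (1 / 2)"
        using \<open>T > 0\<close> n0 by (simp add: ennreal_mult'[symmetric])
      moreover have "ennreal (real n / 2) = of_nat n * ennreal (1 / 2)"
        using ennreal_mult'[of "real n" "1 / 2"] by (simp add: ennreal_of_nat_eq_real_of_nat)
      ultimately show ?thesis by simp
    qed
    also have "\<dots> \<le> (\<Sum>i<n. ennreal (real n / T) * (\<integral>\<^sup>+ \<omega>. ennreal ((?Y i \<omega>)\<^sup>2) \<partial>?N))"
    proof (intro sum_mono mult_left_mono)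
      fix i assume "i \<in> {..<n}"
      then have "?p (Suc i) \<le> T" using pT[of "Suc i"] by simp
      moreover have "?p (Suc i) - ?p i \<le> 1" unfolding p_diff using n n0 by simp
      ultimately show "ennreal (T / real n / 2) \<le> (\<integral>\<^sup>+ \<omega>. ennreal ((?Y i \<omega>)\<^sup>2) \<partial>?N)"
        using unbiased_increment_bound[OF assms(4) unb u p(1,2)] unfolding p_diff by blast
    qed simp
    also have "\<dots> = (\<integral>\<^sup>+ \<omega>. (\<Sum>i<n. ennreal (real n / T) * ennreal ((?Y i \<omega>)\<^sup>2)) \<partial>?N)"
    proof -
      have Ym: "?Y i \<in> borel_measurable ?N" if "i < n" for i
        using p(1)[of i] p(1)[of "Suc i"] pT[of i] pT[of "Suc i"] that
        by (intro borel_measurable_diff meas) auto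
      then show ?thesis
        by (subst nn_integral_sum) (auto intro!: sum.cong nn_integral_cmult[symmetric])
    qed
    also have "\<dots> \<le> ?e"
      using h1_norm_ge_increments[OF \<open>T > 0\<close> n0] by (intro nn_integral_mono)
    finally show ?thesis .
  qed
  obtain r where r: "?e = ennreal r" "0 \<le> r" using fin by (cases ?e) auto
  obtain n :: nat where "max T (2 * r + 1) \<le> real n" using real_arch_simple by blast
  then have n: "T \<le> real n" "r < real n / 2" by auto
  from bound[OF n(1)] n(2) show False unfolding r(1) using r(2) by (simp add: ennreal_le_iff)
qed

end
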